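(* Let $\hat\theta_n$ be a regular asymptotically linear estimator of $\theta_0$ based on the labeled data, with influence function $\phi(x,y)$, and let $\hat\delta_n$ and $\hat\delta_{n+N}$ be regular asymptotically linear estimators of $\delta_0$ based on $(X_i)_{i=1}^n$ and $(X_i)_{i=1}^{n+N}$, respectively, with influence function $\psi(x)$. Define the rectified estimator $$\hat\theta_{\hat\omega}^{\hat\delta}:=\hat\theta_n+\hat\omega\,(\hat\delta_{n+N}-\hat\delta_n).$$ Suppose that $\hat\omega\xrightarrow{p}\omega$ and $\frac nN\to\lambda$. The following hold: (i) Define $$(\sigma_\omega^\psi)^2:=\mathbb E[\phi(X,Y)^2]-\frac{2\omega}{1+\lambda}\mathbb E[\phi(X,Y)\psi(X)]+\frac{\omega^2}{1+\lambda}\mathbb E[\psi(X)^2].$$ Then $\sqrt n\,(\hat\theta_{\hat\omega}^{\hat\delta}-\theta_0)\xrightarrow{d}N\big(0,(\sigma_\omega^\psi)^2\big)$. (ii) Define $\omega^*:=\frac{\mathbb E[\phi(X,Y)\psi(X)]}{\mathbb E[\psi(X)^2]}$. When viewed as a function of $\omega$, $(\sigma_\omega^\psi)^2$ achieves its minimal value of $$(\sigma_{\omega^*}^\psi)^2=\mathbb E[\phi(X,Y)^2]-\frac{(\mathbb E[\phi(X,Y)\psi(X)])^2}{(1+\lambda)\,\mathbb E[\psi(X)^2]}$$ when $\omega=\omega^*$. This is no greater than $\mathbb E[\phi(X,Y)^2]$, the asymptotic variance of $\hat\theta_n$. (iii) Define $\psi^*(X):=\mathbb E[\phi(X,Y)\mid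 X]$. When viewed as a function of $\psi(\cdot)$, $(\sigma_{\omega^*}^\psi)^2$ achieves its minimal value of $$(\sigma_{\omega^*}^{\psi^*})^2:=\mathbb E[\phi(X,Y)^2]-\frac{1}{1+\lambda}\operatorname{Var}\big(\mathbb E[\phi(X,Y)\mid X]\big)$$ when $\psi(X)=\psi^*(X)=\mathbb E[\phi(X,Y)\mid X]$.
   Context: Setting: $(X_1,Y_1),\dots,(X_n,Y_n)$ are i.i.d. from a distribution $\mathbb P^*=\mathbb P^*_X\mathbb P^*_{Y\mid X}$ on $\mathcal X\times\mathcal Y$ (labeled data), and $X_{n+1},\dots,X_{n+N}$ are i.i.d. from $\mathbb P^*_X$ (unlabeled data), independent of the labeled data. All expectations and variances are under $(X,Y)\sim\mathbb P^*$. The target is $\theta_0=\theta(\mathbb P^* )\in\mathbb R$, and $\delta_0=\delta(\mathbb P_X^* )$ is a functional of the marginal law of $X$. Asymptotic linearity with the stated influence functions means $$\hat\theta_n-\theta_0=\frac1n\sum_{i=1}^n\phi(X_i,Y_i)+o_p(n^{-1/2}),$$ $$\hat\delta_n-\delta_0=\frac1n\sum_{i=1}^n\psi(X_i)+o_p(n^{-1/2}),\qquad \hat\delta_{n+N}-\delta_0=\frac1{n+N}\sum_{i=1}^{n+N}\psi(X_i)+o_p(n^{-1/2}),$$ where, as usual, influence functions have mean zero, $\mathbb E[\phi(X,Y)]=\mathbb E[\psi(X)]=0$, and finite variance. Limits are taken as the sample sizes grow. *)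

theory Defs
  imports "HOL-Probability.Probability"
begin

definition normal_law :: "real \<Rightarrow> real \<Rightarrow> real measure" where
  "normal_law m v =
     (if v = 0 then return borel m else density lborel (\<lambda>x. ennreal (normal_density m (sqrt v) x)))"

text \<open>
  Asymptotic notions are stated for triangular arrays: stage \<open>k\<close> has its own probability
  space \<open>M k\<close>, and limits are taken as \<open>k\<close> tends to infinity.
\<close>

definition conv_in_prob :: "(nat \<Rightarrow> 'w measure) \<Rightarrow> (nat \<Rightarrow> 'w \<Rightarrow> real) \<Rightarrow> real \<Rightarrow> bool" where
  "conv_in_prob M Z c \<longleftrightarrow>
     (\<forall>\<epsilon>>0. (\<lambda>k. measure (M k) {w \<in> space (M k). \<bar>Z k w - c\<bar> > \<epsilon>}) \<longlonglongrightarrow> 0)"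

definition conv_in_dist :: "(nat \<Rightarrow> 'w measure) \<Rightarrow> (nat \<Rightarrow> 'w \<Rightarrow> real) \<Rightarrow> real measure \<Rightarrow> bool" where
  "conv_in_dist M Z L \<longleftrightarrow> weak_conv_m (\<lambda>k. distr (M k) borel (Z k)) L"

definition small_op :: "(nat \<Rightarrow> 'w measure) \<Rightarrow> (nat \<Rightarrow> 'w \<Rightarrow> real) \<Rightarrow> (nat \<Rightarrow> real) \<Rightarrow> bool" where
  "small_op M R a \<longleftrightarrow> conv_in_prob M (\<lambda>k w. R k w / a k) 0"

definition labeled_data ::
    "(nat \<Rightarrow> 'w \<Rightarrow> 'x) \<Rightarrow> (nat \<Rightarrow> 'w \<Rightarrow> 'y) \<Rightarrow> nat set \<Rightarrow> 'w \<Rightarrow> nat \<Rightarrow> 'x \<times> 'y" where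
  "labeled_data X Y I w = (\<lambda>i\<in>I. (X i w, Y i w))"

definition covariate_data :: "(nat \<Rightarrow> 'w \<Rightarrow> 'x) \<Rightarrow> nat set \<Rightarrow> 'w \<Rightarrow> nat \<Rightarrow> 'x" where
  "covariate_data X I w = (\<lambda>i\<in>I. X i w)"

definition X_marginal :: "'x measure \<Rightarrow> ('x \<times> 'y) measure \<Rightarrow> 'x measure" where
  "X_marginal SX P = distr P SX fst"

text \<open>
  Observations are indexed from 0: the labeled ones by \<open>{..<n}\<close>, the unlabeled ones by
  \<open>{n..<n + N}\<close>. The values \<open>Y i\<close> with \<open>i \<ge> n\<close> are unconstrained and never used.
\<close>

definition semisupervised_sample ::
    "'w measure \<Rightarrow> 'x measure \<Rightarrow> 'y measure \<Rightarrow> ('x \<times> 'y) measure \<Rightarrow>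
     (nat \<Rightarrow> 'w \<Rightarrow> 'x) \<Rightarrow> (nat \<Rightarrow> 'w \<Rightarrow> 'y) \<Rightarrow> nat \<Rightarrow> nat \<Rightarrow> bool" where
  "semisupervised_sample M SX SY P X Y n N \<longleftrightarrow>
     prob_space M \<and>
     prob_space.indep_vars M (\<lambda>_. SX \<Otimes>\<^sub>M SY) (\<lambda>i w. (X i w, Y i w)) {..<n} \<and>
     (\<forall>i\<in>{..<n}. distr M (SX \<Otimes>\<^sub>M SY) (\<lambda>w. (X i w, Y i w)) = P) \<and>
     prob_space.indep_vars M (\<lambda>_. SX) X {n..<n + N} \<and>
     (\<forall>i\<in>{n..<n + N}. distr M SX (X i) = X_marginal SX P) \<and>
     prob_space.indep_set M
       (sets (vimage_algebra (space M) (labeled_data X Y {..<n}) (Pi\<^sub>M {..<n} (\<lambda>_. SX \<Otimes>\<^sub>M SY))))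
       (sets (vimage_algebra (space M) (covariate_data X {n..<n + N}) (Pi\<^sub>M {n..<n + N} (\<lambda>_. SX))))"

definition influence_function :: "'a measure \<Rightarrow> ('a \<Rightarrow> real) \<Rightarrow> bool" where
  "influence_function P f \<longleftrightarrow>
     f \<in> borel_measurable P \<and> integrable P (\<lambda>z. (f z)\<^sup>2) \<and> (\<integral>z. f z \<partial>P) = 0"

text \<open>
  At stage \<open>k\<close> the estimator \<open>T k\<close> is applied to \<open>m k\<close> observations \<open>D k\<close>; the remainder is
  \<open>o\<^sub>p(r\<^sub>k\<^sup>-\<^sup>1\<^sup>/\<^sup>2)\<close>, where \<open>r\<close> may differ from \<open>m\<close> (for the pooled sample, \<open>m = n + N\<close> but \<open>r = n\<close>).
\<close>

definition asymptotically_linear ::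
    "(nat \<Rightarrow> 'w measure) \<Rightarrow> (nat \<Rightarrow> nat) \<Rightarrow> (nat \<Rightarrow> nat) \<Rightarrow> (nat \<Rightarrow> 'w \<Rightarrow> nat \<Rightarrow> 'a) \<Rightarrow>
     (nat \<Rightarrow> (nat \<Rightarrow> 'a) \<Rightarrow> real) \<Rightarrow> real \<Rightarrow> ('a \<Rightarrow> real) \<Rightarrow> bool" where
  "asymptotically_linear M r m D T \<tau> f \<longleftrightarrow>
     small_op M (\<lambda>k w. T k (D k w) - \<tau> - (\<Sum>i<m k. f (D k w i)) / real (m k))
       (\<lambda>k. real (r k) powr (- 1 / 2))"

text \<open>
  A one-dimensional dominated submodel \<open>t \<mapsto> p t\<close> (\<open>t \<ge> 0\<close>) through \<open>P\<close> that is differentiable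
  in quadratic mean at \<open>t = 0\<close> from the right, with score \<open>g\<close>.
\<close>

definition qmd_submodel :: "'a measure \<Rightarrow> (real \<Rightarrow> 'a measure) \<Rightarrow> bool" where
  "qmd_submodel P p \<longleftrightarrow>
     p 0 = P \<and> (\<forall>t\<ge>0. prob_space (p t)) \<and>
     (\<exists>\<nu> f g. sigma_finite_measure \<nu> \<and> sets \<nu> = sets P \<and>
        (\<forall>t\<ge>0. f t \<in> borel_measurable \<nu> \<and> (\<forall>x. 0 \<le> f t x) \<and>
                 p t = density \<nu> (\<lambda>x. ennreal (f t x))) \<and>
        g \<in> borel_measurable \<nu> \<and>
        ((\<lambda>t. \<integral>\<^sup>+x. ennreal (((sqrt (f t x) - sqrt (f 0 x)) / t - g x * sqrt (f 0 x) / 2)\<^sup>2) \<partial>\<nu>)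
           \<longlongrightarrow> 0) (at_right 0))"

text \<open>
  Regularity relative to a collection of submodels: the law of \<open>\<surd>m (T - \<tau>(p\<^sub>t))\<close> under \<open>m\<close> i.i.d.
  draws from the local alternative \<open>p\<^sub>t\<close>, \<open>t = 1/\<surd>m\<close>, has a limit that is the same for all submodels.
\<close>

definition regular_estimator ::
    "(real \<Rightarrow> 'a measure) set \<Rightarrow> (nat \<Rightarrow> nat) \<Rightarrow> (nat \<Rightarrow> (nat \<Rightarrow> 'a) \<Rightarrow> real) \<Rightarrow>
     ('a measure \<Rightarrow> real) \<Rightarrow> bool" where
  "regular_estimator \<P> m T \<tau> \<longleftrightarrow>
     (\<exists>L. real_distribution L \<and>
        (\<forall>p\<in>\<P>. conv_in_dist
           (\<lambda>k. Pi\<^sub>M {..<m k} (\<lambda>_. p (1 / sqrt (real (m k)))))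
           (\<lambda>k d. sqrt (real (m k)) * (T k d - \<tau> (p (1 / sqrt (real (m k)))))) L))"

definition rectified_estimator :: "real \<Rightarrow> real \<Rightarrow> real \<Rightarrow> real \<Rightarrow> real" where
  "rectified_estimator t w d_all d_lab = t + w * (d_all - d_lab)"

definition asymp_var ::
    "('x \<times> 'y) measure \<Rightarrow> (('x \<times> 'y) \<Rightarrow> real) \<Rightarrow> real \<Rightarrow> ('x \<Rightarrow> real) \<Rightarrow> real \<Rightarrow> real" where
  "asymp_var P \<phi> lam \<psi> \<omega> =
     (\<integral>z. (\<phi> z)\<^sup>2 \<partial>P)
     - 2 * \<omega> / (1 + lam) * (\<integral>z. \<phi> z * \<psi> (fst z) \<partial>P)
     + \<omega>\<^sup>2 / (1 + lam) * (\<integral>z. (\<psi> (fst z))\<^sup>2 \<partial>P)"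

text \<open>
  If \<open>\<psi>(X) = 0\<close> almost surely, the quotient is 0/0, which is 0 in HOL; in that case
  \<open>asymp_var\<close> does not depend on \<open>\<omega>\<close>.
\<close>

definition omega_opt ::
    "('x \<times> 'y) measure \<Rightarrow> (('x \<times> 'y) \<Rightarrow> real) \<Rightarrow> ('x \<Rightarrow> real) \<Rightarrow> real" where
  "omega_opt P \<phi> \<psi> = (\<integral>z. \<phi> z * \<psi> (fst z) \<partial>P) / (\<integral>z. (\<psi> (fst z))\<^sup>2 \<partial>P)"

definition cond_exp_given_X ::
    "'x measure \<Rightarrow> ('x \<times> 'y) measure \<Rightarrow> (('x \<times> 'y) \<Rightarrow> real) \<Rightarrow> ('x \<times> 'y) \<Rightarrow> real" where
  "cond_exp_given_X SX P \<phi> = real_cond_exp P (vimage_algebra (space P) fst SX) \<phi>"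

text \<open>No disintegration of \<open>P\<close> is assumed: \<open>h\<close> is a version of \<open>x \<mapsto> E[\<phi>(X,Y) | X = x]\<close>.\<close>

definition regression_version ::
    "'x measure \<Rightarrow> ('x \<times> 'y) measure \<Rightarrow> (('x \<times> 'y) \<Rightarrow> real) \<Rightarrow> ('x \<Rightarrow> real) \<Rightarrow> bool" where
  "regression_version SX P \<phi> h \<longleftrightarrow>
     h \<in> borel_measurable SX \<and> (AE z in P. h (fst z) = cond_exp_given_X SX P \<phi> z)"

end

theory Submission
  imports Defs "HOL-Real_Asymp.Real_Asymp"
begin

text \<open>
  Put \<open>c\<^sub>k = N/(n + N)\<close>, \<open>d\<^sub>k = \<surd>(n N)/(n + N)\<close>, and let \<open>U\<close>, \<open>V\<close> be the normalized sums of
  \<open>\<psi>\<close> over the labeled and the unlabeled covariates. Since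
  \<open>\<surd>n (\<delta>_all - \<delta>_lab) = - c\<^sub>k U + d\<^sub>k V + o\<^sub>p(1)\<close>, where \<open>c\<^sub>k \<rightarrow> c = 1/(1 + \<lambda>)\<close> and
  \<open>d\<^sub>k \<rightarrow> d = \<surd>\<lambda>/(1 + \<lambda>)\<close>, the error of the rectified estimator is, up to \<open>o\<^sub>p(1)\<close>, the
  normalized labeled sum of \<open>\<phi> - c \<omega> \<psi>\<close> plus the independent normalized unlabeled sum of
  \<open>\<omega> d \<psi>\<close>. Characteristic functions give the Gaussian limit, whose variance is as claimed because
  \<open>c\<^sup>2 + d\<^sup>2 = c\<close>. Part (ii) is the minimization of a quadratic in \<open>\<omega>\<close>. In part (iii),
  \<open>E[\<phi> f(X)] = E[h(X) f(X)]\<close> for the regression function \<open>h\<close>, and the Cauchy--Schwarz inequality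
  shows that \<open>E[h f]\<^sup>2 / E[f\<^sup>2]\<close> is largest at \<open>f = h\<close>.
\<close>

section \<open>Central limit theorem through powers of a characteristic function\<close>

text \<open>
  Both the characteristic function and the Gaussian one are \<open>n\<close>-th powers, so it suffices that
  their bases differ by \<open>o(1/n)\<close>; in this form the degenerate case of variance 0 needs no separate
  treatment.
\<close>

lemma (in real_distribution) char_power_tendsto_gaussian:
  assumes int: "integrable M (\<lambda>x. x\<^sup>2)" and mean: "expectation (\<lambda>x. x) = 0"
  shows "(\<lambda>n. char M (t / sqrt (real n)) ^ n) \<longlonglongrightarrow> exp (- (expectation (\<lambda>x. x\<^sup>2) * t\<^sup>2 / 2))"
proof -
  define v where "v = expectation (\<lambda>x. x\<^sup>2)"
  have v: "v \<ge> 0"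
    unfolding v_def by simp
  have int1: "integrable M (\<lambda>x. x)"
    by (rule square_integrable_imp_integrable[OF _ int]) simp
  \<comment> \<open>\<open>t\<^sup>2 / 6 * g n\<close> bounds \<open>n\<close> times the distance of
    the base \<open>char M (t / sqrt n)\<close> from the expansion
    \<open>1 - v * t\<^sup>2 / (2 * n)\<close>; \<open>q n\<close> is \<open>n\<close> times the
    distance of the Gaussian base from that same expansion.\<close>
  define g where "g n = (LINT x|M. min (6 * x\<^sup>2) (\<bar>t / sqrt (real n)\<bar> * \<bar>x\<bar> ^ 3))" for n
  define q where "q n = \<bar>real n * (exp (- (v * t\<^sup>2 / 2) / real n) - (1 + (- (v * t\<^sup>2 / 2)) / real n))\<bar>" for n
  have "(\<lambda>n. min (6 * x\<^sup>2) (\<bar>t / sqrt (real n)\<bar> * \<bar>x\<bar> ^ 3)) \<longlonglongrightarrow> 0" for x :: real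
  proof -
    have "(\<lambda>n. c / sqrt (real n)) \<longlonglongrightarrow> 0" for c :: real by real_asymp
    from this[of "\<bar>t\<bar> * \<bar>x\<bar> ^ 3"]
    have "(\<lambda>n. \<bar>t / sqrt (real n)\<bar> * \<bar>x\<bar> ^ 3) \<longlonglongrightarrow> 0" by simp
    from tendsto_min[OF tendsto_const[of "6 * x\<^sup>2"] this] show ?thesis by simp
  qed
  \<comment> \<open>The cubic branch of the minimum forces the pointwise limit 0, while the
    quadratic branch is an integrable majorant free of \<open>n\<close>. So second moments
    suffice.\<close>
  then have "g \<longlonglongrightarrow> (LINT x|M. 0)"
    unfolding g_def using int
    by (intro integral_dominated_convergence[where w = "\<lambda>x. 6 * x\<^sup>2"]) auto
  then have g0: "(\<lambda>n. t\<^sup>2 / 6 * g n) \<longlonglongrightarrow> 0"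
    by (simp add: tendsto_mult_right_zero)
  have "(\<lambda>n. real n * (exp (c / real n) - (1 + c / real n))) \<longlonglongrightarrow> 0" for c :: real
    by real_asymp
  from tendsto_rabs_zero[OF this[of "- (v * t\<^sup>2 / 2)"]] have q0: "q \<longlonglongrightarrow> 0"
    unfolding q_def .
  have bound: "cmod (char M (t / sqrt (real n)) ^ n - exp (- (v * t\<^sup>2 / 2))) \<le> t\<^sup>2 / 6 * g n + q n"
    if n: "n > 0" for n
  proof -
    let ?s = "t / sqrt (real n)"
    define a where "a = 1 + (- (v * t\<^sup>2 / 2)) / real n"
    define b where "b = exp (- (v * t\<^sup>2 / 2) / real n)"
    \<comment> \<open>Taking \<open>n\<close>-th powers costs only a factor \<open>n\<close> because
      both bases lie in the closed unit disc; for \<open>b\<close> this uses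
      \<open>v \<ge> 0\<close>.\<close>
    have b01: "0 \<le> b" "b \<le> 1" using v by (simp_all add: b_def)
    have s2: "?s\<^sup>2 = t\<^sup>2 / real n" by (simp add: power_divide)
    have "exp (- (v * t\<^sup>2 / 2)) = b ^ n"
      using n by (simp add: b_def flip: exp_of_nat_mult)
    then have "cmod (char M ?s ^ n - exp (- (v * t\<^sup>2 / 2))) = cmod (char M ?s ^ n - complex_of_real b ^ n)"
      by (simp only: of_real_power)
    also have "\<dots> \<le> n * cmod (char M ?s - complex_of_real b)"
      using b01 by (intro norm_power_diff cmod_char_le_1) simp_all
    also have "\<dots> \<le> n * (t\<^sup>2 / real n / 6 * g n + \<bar>b - a\<bar>)"
    proof (rule mult_left_mono)
      have "cmod (char M ?s - complex_of_real a) \<le> t\<^sup>2 / real n / 6 * g n"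
        using char_approx3[OF int1 mean int, of v ?s]
        by (simp add: mean v_def[symmetric] s2 g_def a_def mult.commute)
      moreover have "cmod (complex_of_real a - complex_of_real b) = \<bar>b - a\<bar>"
        by (simp add: abs_minus_commute flip: of_real_diff)
      ultimately show "cmod (char M ?s - complex_of_real b) \<le> t\<^sup>2 / real n / 6 * g n + \<bar>b - a\<bar>"
        using norm_triangle_ineq[of "char M ?s - complex_of_real a" "complex_of_real a - complex_of_real b"]
        by simp
    qed simp
    also have "\<dots> = t\<^sup>2 / 6 * g n + q n"
      using n by (simp add: q_def a_def b_def abs_mult distrib_left)
    finally show ?thesis .
  qed
  show ?thesis
    unfolding v_def[symmetric]
  proof (rule LIM_zero_cancel, rule Lim_null_comparison)
    show "\<forall>\<^sub>F n in sequentially. cmod (char M (t / sqrt (real n)) ^ n - exp (- (v * t\<^sup>2 / 2))) \<le> t\<^sup>2 / 6 * g n + q n"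
      using eventually_gt_at_top[of 0] by eventually_elim (rule bound)
    show "(\<lambda>n. t\<^sup>2 / 6 * g n + q n) \<longlonglongrightarrow> 0"
      using tendsto_add[OF g0 q0] by simp
  qed
qed

section \<open>The normal law, including variance 0\<close>

text \<open>An affine image of a standard normal variable also describes the point mass at
  \<open>m\<close>, which is the case \<open>sqrt v = 0\<close>. Total mass and characteristic
  function then follow for all \<open>v \<ge> 0\<close> at once.\<close>

lemma normal_law_eq_distr:
  assumes "v \<ge> 0"
  shows "normal_law m v = distr std_normal_distribution borel (\<lambda>x. m + sqrt v * x)"
proof (cases "v = 0")
  case True
  interpret prob_space std_normal_distribution
    by (rule prob_space_normal_density) simp
  show ?thesis
    using True distr_const[of m borel] by (simp add: normal_law_def)
next
  case False
  with assms have s: "sqrt v > 0" by simp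
  interpret prob_space std_normal_distribution
    by (rule prob_space_normal_density) simp
  have "distributed std_normal_distribution lborel (\<lambda>x. x) std_normal_density"
    by (simp add: distributed_def distr_id2)
  then have "distributed std_normal_distribution lborel (\<lambda>x. m + sqrt v * x) (normal_density m (sqrt v))"
    using s normal_standard_normal_convert[OF s, of "\<lambda>x. m + sqrt v * x" m] by simp
  then show ?thesis
    using False by (simp add: normal_law_def distributed_def cong: distr_cong)
qed

lemma real_distribution_normal_law:
  assumes "v \<ge> 0"
  shows "real_distribution (normal_law m v)"
proof -
  interpret prob_space std_normal_distribution
    by (rule prob_space_normal_density) simp
  show ?thesis by (simp add: normal_law_eq_distr[OF assms])
qed

lemma char_normal_law:
  assumes "v \<ge> 0"
  shows "char (normal_law 0 v) t = exp (- (v * t\<^sup>2 / 2))"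
proof -
  have "char (normal_law 0 v) t = char std_normal_distribution (t * sqrt v)"
    by (simp add: normal_law_eq_distr[OF assms] char_def integral_distr mult.assoc)
  then show ?thesis
    using assms by (simp add: char_std_normal_distribution power_mult_distrib mult.commute)
qed

section \<open>Slutsky-type arguments for triangular arrays\<close>

lemma cmod_iexp_diff_le: "cmod (iexp a - iexp b) \<le> \<bar>a - b\<bar>"
proof -
  have "iexp a - iexp b = iexp b * (iexp (a - b) - 1)"
    by (simp add: right_diff_distrib exp_diff)
  then have "cmod (iexp a - iexp b) = cmod (iexp (a - b) - 1)"
    by (simp add: norm_mult)
  also have "\<dots> \<le> \<bar>a - b\<bar>"
    using iexp_approx1[of "a - b" 0] by simp
  finally show ?thesis .
qed

text \<open>The integrand is split by the event that \<open>Z\<close> and \<open>S\<close> differ by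
  more than \<open>e\<close>. Off it, \<open>iexp\<close> is Lipschitz and contributes at most
  \<open>\<bar>t\<bar> * e\<close>; on it, two unit complex numbers are at distance at most
  2.\<close>

lemma (in prob_space) char_distr_diff_le:
  assumes [measurable]: "Z \<in> borel_measurable M" "S \<in> borel_measurable M" and e: "e > 0"
  shows "cmod (char (distr M borel Z) t - char (distr M borel S) t)
    \<le> \<bar>t\<bar> * e + 2 * prob {w \<in> space M. \<bar>Z w - S w\<bar> > e}"
proof -
  let ?A = "{w \<in> space M. \<bar>Z w - S w\<bar> > e}"
  have ii: "integrable M (\<lambda>w. iexp (t * Z w))" "integrable M (\<lambda>w. iexp (t * S w))"
    by (auto intro!: integrable_iexp)
  have "cmod (char (distr M borel Z) t - char (distr M borel S) t)
      = cmod (\<integral>w. iexp (t * Z w) - iexp (t * S w) \<partial>M)"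
    using ii by (simp add: char_def integral_distr)
  also have "\<dots> \<le> (\<integral>w. cmod (iexp (t * Z w) - iexp (t * S w)) \<partial>M)"
    by (rule integral_norm_bound)
  also have "\<dots> \<le> (\<integral>w. \<bar>t\<bar> * e + 2 * indicator ?A w \<partial>M)"
  proof (rule integral_mono)
    show "integrable M (\<lambda>w. cmod (iexp (t * Z w) - iexp (t * S w)))"
      using ii by (intro integrable_norm Bochner_Integration.integrable_diff)
    show "integrable M (\<lambda>w. \<bar>t\<bar> * e + 2 * indicator ?A w)"
      by (intro Bochner_Integration.integrable_add integrable_mult_right) (auto simp: emeasure_eq_measure)
    fix w assume w: "w \<in> space M"
    show "cmod (iexp (t * Z w) - iexp (t * S w)) \<le> \<bar>t\<bar> * e + 2 * indicator ?A w"
    proof (cases "w \<in> ?A")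
      case True
      have "cmod (iexp (t * Z w) - iexp (t * S w)) \<le> cmod (iexp (t * Z w)) + cmod (iexp (t * S w))"
        by (rule norm_triangle_ineq4)
      also have "\<dots> = 2" by simp
      finally show ?thesis
        using True e by (simp add: add_increasing)
    next
      case False
      have "cmod (iexp (t * Z w) - iexp (t * S w)) \<le> \<bar>t * Z w - t * S w\<bar>"
        by (rule cmod_iexp_diff_le)
      also have "\<dots> = \<bar>t\<bar> * \<bar>Z w - S w\<bar>"
        by (simp add: abs_mult flip: right_diff_distrib)
      also have "\<dots> \<le> \<bar>t\<bar> * e"
        using False w by (intro mult_left_mono) auto
      finally show ?thesis using False by simp
    qed
  qed
  also have "\<dots> = \<bar>t\<bar> * e + 2 * prob ?A"
    by (subst Bochner_Integration.integral_add) (auto simp: emeasure_eq_measure prob_space)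
  finally show ?thesis .
qed

text \<open>The vanishing difference carries the limit of the characteristic functions over from
  \<open>S\<close> to \<open>Z\<close>, and Levy's continuity theorem turns it into weak
  convergence.\<close>

lemma conv_in_dist_slutsky:
  assumes prob: "\<And>k. prob_space (M k)"
    and meas: "\<And>k. Z k \<in> borel_measurable (M k)" "\<And>k. S k \<in> borel_measurable (M k)"
    and rem: "conv_in_prob M (\<lambda>k w. Z k w - S k w) 0"
    and char: "\<And>t. (\<lambda>k. char (distr (M k) borel (S k)) t) \<longlonglongrightarrow> char L t"
    and L: "real_distribution L"
  shows "conv_in_dist M Z L"
  unfolding conv_in_dist_def
proof (rule levy_continuity)
  show "real_distribution (distr (M k) borel (Z k))" for k
    using prob meas by (simp add: prob_space.real_distribution_distr)
  fix t
  have "(\<lambda>k. char (distr (M k) borel (Z k)) t - char (distr (M k) borel (S k)) t) \<longlonglongrightarrow> 0"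
  proof (rule LIMSEQ_I)
    fix r :: real assume r: "r > 0"
    \<comment> \<open>With this \<open>e\<close> the Lipschitz part stays below
      \<open>r / 2\<close>, also for \<open>t = 0\<close> thanks to the added 1; the probability
      part, less than twice \<open>r / 4\<close>, supplies the other half.\<close>
    define e where "e = r / (2 * (\<bar>t\<bar> + 1))"
    have e: "e > 0" using r by (simp add: e_def)
    have te: "\<bar>t\<bar> * e < r / 2"
      using r by (simp add: e_def field_simps)
    have "(\<lambda>k. measure (M k) {w \<in> space (M k). \<bar>Z k w - S k w\<bar> > e}) \<longlonglongrightarrow> 0"
      using rem e by (simp add: conv_in_prob_def)
    from LIMSEQ_D[OF this, of "r / 4"] r obtain k0 where
      k0: "\<And>k. k \<ge> k0 \<Longrightarrow> measure (M k) {w \<in> space (M k). \<bar>Z k w - S k w\<bar> > e} < r / 4"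
      by auto
    have "cmod (char (distr (M k) borel (Z k)) t - char (distr (M k) borel (S k)) t) < r" if "k \<ge> k0" for k
      using prob_space.char_distr_diff_le[OF prob meas(1) meas(2) e, of k t] k0[OF that] te by simp
    then show "\<exists>no. \<forall>n\<ge>no. cmod (char (distr (M n) borel (Z n)) t - char (distr (M n) borel (S n)) t - 0) < r"
      by auto
  qed
  from tendsto_add[OF this char[of t]]
  show "(\<lambda>k. char (distr (M k) borel (Z k)) t) \<longlonglongrightarrow> char L t" by simp
qed (rule L)

lemma conv_in_prob_const:
  assumes "c \<longlonglongrightarrow> l"
  shows "conv_in_prob M (\<lambda>k _. c k) l"
  unfolding conv_in_prob_def
proof safe
  fix e :: real assume "e > 0"
  then have "eventually (\<lambda>k. \<bar>c k - l\<bar> < e) sequentially"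
    using assms by (simp add: tendsto_iff dist_real_def)
  then show "(\<lambda>k. measure (M k) {w \<in> space (M k). \<bar>c k - l\<bar> > e}) \<longlonglongrightarrow> 0"
    by (intro tendsto_eventually) (auto elim!: eventually_mono)
qed

text \<open>If both coordinates are within \<open>r\<close> of \<open>(a, b)\<close>, continuity at
  this one point keeps \<open>g\<close> within \<open>e\<close>. So the deviation event is covered
  by two coordinate events whose probabilities vanish. Sums and products are the instances used
  later.\<close>

lemma conv_in_prob_continuous:
  fixes g :: "real \<times> real \<Rightarrow> real"
  assumes prob: "\<And>k. prob_space (M k)"
    and [measurable]: "\<And>k. Z k \<in> borel_measurable (M k)" "\<And>k. W k \<in> borel_measurable (M k)"
    and conv: "conv_in_prob M Z a" "conv_in_prob M W b"
    and g: "isCont g (a, b)"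
  shows "conv_in_prob M (\<lambda>k w. g (Z k w, W k w)) (g (a, b))"
  unfolding conv_in_prob_def
proof safe
  fix e :: real assume "e > 0"
  with g obtain d where d: "d > 0" "\<And>p. dist p (a, b) < d \<Longrightarrow> dist (g p) (g (a, b)) < e"
    unfolding continuous_at_eps_delta by blast
  define r where "r = d / 3"
  have r: "r > 0" using d by (simp add: r_def)
  let ?A = "\<lambda>k. {w \<in> space (M k). \<bar>Z k w - a\<bar> > r}" and ?B = "\<lambda>k. {w \<in> space (M k). \<bar>W k w - b\<bar> > r}"
  have sub: "{w \<in> space (M k). \<bar>g (Z k w, W k w) - g (a, b)\<bar> > e} \<subseteq> ?A k \<union> ?B k" for k
  proof (rule subsetI, rule ccontr)
    fix w assume w: "w \<in> {w \<in> space (M k). \<bar>g (Z k w, W k w) - g (a, b)\<bar> > e}" "w \<notin> ?A k \<union> ?B k"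
    have "dist (Z k w, W k w) (a, b) \<le> \<bar>Z k w - a\<bar> + \<bar>W k w - b\<bar>"
      by (simp add: dist_Pair_Pair dist_real_def sqrt_sum_squares_le_sum_abs[of "Z k w - a", simplified])
    also have "\<dots> < d" using w d by (simp add: r_def)
    finally show False using d(2)[of "(Z k w, W k w)"] w by (simp add: dist_real_def)
  qed
  have lim: "(\<lambda>k. measure (M k) (?A k) + measure (M k) (?B k)) \<longlonglongrightarrow> 0"
    using tendsto_add[of "\<lambda>k. measure (M k) (?A k)" 0 _ "\<lambda>k. measure (M k) (?B k)" 0] conv r
    by (simp add: conv_in_prob_def)
  show "(\<lambda>k. measure (M k) {w \<in> space (M k). \<bar>g (Z k w, W k w) - g (a, b)\<bar> > e}) \<longlonglongrightarrow> 0"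
  proof (rule tendsto_sandwich[OF _ _ tendsto_const lim])
    have "measure (M k) {w \<in> space (M k). \<bar>g (Z k w, W k w) - g (a, b)\<bar> > e}
        \<le> measure (M k) (?A k) + measure (M k) (?B k)" for k
    proof -
      interpret prob_space "M k" by (rule prob)
      have "prob {w \<in> space (M k). \<bar>g (Z k w, W k w) - g (a, b)\<bar> > e} \<le> prob (?A k \<union> ?B k)"
        by (rule finite_measure_mono[OF sub]) measurable
      also have "\<dots> \<le> prob (?A k) + prob (?B k)"
        by (rule measure_Un_le) measurable
      finally show ?thesis .
    qed
    then show "\<forall>\<^sub>F k in sequentially. measure (M k) {w \<in> space (M k). \<bar>g (Z k w, W k w) - g (a, b)\<bar> > e}
        \<le> measure (M k) (?A k) + measure (M k) (?B k)" by simp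
  qed simp
qed

lemma conv_in_prob_add:
  assumes "\<And>k. prob_space (M k)"
    and "\<And>k. Z k \<in> borel_measurable (M k)" "\<And>k. W k \<in> borel_measurable (M k)"
    and "conv_in_prob M Z a" "conv_in_prob M W b"
  shows "conv_in_prob M (\<lambda>k w. Z k w + W k w) (a + b)"
  using conv_in_prob_continuous[OF assms, of "\<lambda>p. fst p + snd p"] by (simp add: continuous_intros)

lemma conv_in_prob_mult:
  assumes "\<And>k. prob_space (M k)"
    and "\<And>k. Z k \<in> borel_measurable (M k)" "\<And>k. W k \<in> borel_measurable (M k)"
    and "conv_in_prob M Z a" "conv_in_prob M W b"
  shows "conv_in_prob M (\<lambda>k w. Z k w * W k w) (a * b)"
  using conv_in_prob_continuous[OF assms, of "\<lambda>p. fst p * snd p"] by (simp add: continuous_intros)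

text \<open>Bounded second moments make \<open>W\<close> tight: by Markov's inequality,
  \<open>(W k w)\<^sup>2\<close> reaches a large \<open>K\<close> with small probability, uniformly
  in \<open>k\<close>. This handles the errors from replacing random weights by their limits, where
  \<open>W\<close> is a normalized sum.\<close>

lemma conv_in_prob_mult_bounded:
  assumes prob: "\<And>k. prob_space (M k)"
    and [measurable]: "\<And>k. Z k \<in> borel_measurable (M k)" "\<And>k. W k \<in> borel_measurable (M k)"
    and conv: "conv_in_prob M Z 0"
    and int: "\<And>k. integrable (M k) (\<lambda>w. (W k w)\<^sup>2)"
    and bound: "\<And>k. (\<integral>w. (W k w)\<^sup>2 \<partial>M k) \<le> C"
  shows "conv_in_prob M (\<lambda>k w. Z k w * W k w) 0"
  unfolding conv_in_prob_def
proof safe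
  fix e :: real assume e: "e > 0"
  have C: "C \<ge> 0" using bound[of 0] by (rule order_trans[rotated]) simp
  let ?E = "\<lambda>k. {w \<in> space (M k). \<bar>Z k w * W k w - 0\<bar> > e}"
  show "(\<lambda>k. measure (M k) (?E k)) \<longlonglongrightarrow> 0"
  proof (rule LIMSEQ_I)
    fix r :: real assume r: "r > 0"
    \<comment> \<open>Chosen so that the Markov bound \<open>C / K\<close> is below
      \<open>r / 2\<close>; the 1 keeps \<open>K\<close> positive if \<open>C = 0\<close>. The
      threshold \<open>d\<close> below satisfies \<open>d * sqrt K = e\<close>.\<close>
    define K where "K = 2 * C / r + 1"
    have K: "K > 0" using C r by (simp add: K_def add_nonneg_pos)
    have CK: "C / K < r / 2"
      using C r K by (simp add: K_def field_simps)
    define d where "d = e / (sqrt K)"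
    have d: "d > 0" using e K by (simp add: d_def)
    let ?A = "\<lambda>k. {w \<in> space (M k). \<bar>Z k w - 0\<bar> > d}" and ?B = "\<lambda>k. {w \<in> space (M k). (W k w)\<^sup>2 \<ge> K}"
    have le: "measure (M k) (?E k) \<le> measure (M k) (?A k) + C / K" for k
    proof -
      interpret prob_space "M k" by (rule prob)
      have "?E k \<subseteq> ?A k \<union> ?B k"
      proof (rule subsetI, rule ccontr)
        fix w assume w: "w \<in> ?E k" "w \<notin> ?A k \<union> ?B k"
        then have "\<bar>Z k w\<bar> \<le> d" "(W k w)\<^sup>2 \<le> K" by auto
        then have "\<bar>Z k w\<bar> * \<bar>W k w\<bar> \<le> d * sqrt K"
          using d by (intro mult_mono) (auto intro: real_le_rsqrt)
        with w K show False by (simp add: d_def abs_mult)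
      qed
      then have "prob (?E k) \<le> prob (?A k \<union> ?B k)"
        by (rule finite_measure_mono) measurable
      also have "\<dots> \<le> prob (?A k) + prob (?B k)"
        by (rule measure_Un_le) measurable
      also have "prob (?B k) \<le> (\<integral>w. (W k w)\<^sup>2 \<partial>M k) / K"
        using integral_Markov_inequality_measure[OF int[of k] sets.empty_sets _ K] by simp
      also have "\<dots> \<le> C / K" using bound[of k] K by (simp add: divide_right_mono)
      finally show ?thesis by simp
    qed
    have "(\<lambda>k. measure (M k) (?A k)) \<longlonglongrightarrow> 0"
      using conv d by (simp add: conv_in_prob_def)
    from LIMSEQ_D[OF this, of "r / 2"] r obtain k0 where
      k0: "\<And>k. k \<ge> k0 \<Longrightarrow> measure (M k) (?A k) < r / 2" by auto
    have "norm (measure (M k) (?E k) - 0) < r" if "k \<ge> k0" for k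
      using le[of k] k0[OF that] CK unfolding diff_0_right real_norm_def abs_of_nonneg[OF measure_nonneg]
      by linarith
    then show "\<exists>no. \<forall>n\<ge>no. norm (measure (M n) (?E n) - 0) < r" by blast
  qed
qed

section \<open>Second moments and square-integrable functions\<close>

text \<open>Each new summand is centred and independent of the sum so far, so the cross term has
  expectation 0. Integrability goes through the same induction.\<close>

lemma (in prob_space) second_moment_sum_indep:
  fixes f :: "'i \<Rightarrow> 'a \<Rightarrow> real"
  assumes "finite I" "indep_vars (\<lambda>_. borel) f I"
    and "\<And>i. i \<in> I \<Longrightarrow> integrable M (\<lambda>w. (f i w)\<^sup>2)" "\<And>i. i \<in> I \<Longrightarrow> expectation (f i) = 0"
  shows "integrable M (\<lambda>w. (\<Sum>i\<in>I. f i w)\<^sup>2) \<and>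
    expectation (\<lambda>w. (\<Sum>i\<in>I. f i w)\<^sup>2) = (\<Sum>i\<in>I. expectation (\<lambda>w. (f i w)\<^sup>2))"
  using assms
proof (induction I)
  case (insert i I)
  let ?S = "\<lambda>w. \<Sum>j\<in>I. f j w"
  have "indep_vars (\<lambda>_. borel) f I"
    using insert.prems(1) by (rule indep_vars_subset) auto
  with insert have IH: "integrable M (\<lambda>w. (?S w)\<^sup>2)"
    "expectation (\<lambda>w. (?S w)\<^sup>2) = (\<Sum>i\<in>I. expectation (\<lambda>w. (f i w)\<^sup>2))"
    by auto
  have ind: "indep_var borel (f i) borel ?S"
    using insert by (intro indep_vars_sum) auto
  note rv = indep_var_rv1[OF ind] indep_var_rv2[OF ind]
  have fi: "integrable M (\<lambda>w. (f i w)\<^sup>2)" "expectation (f i) = 0"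
    using insert.prems by auto
  have i1: "integrable M (f i)" "integrable M ?S"
    using square_integrable_imp_integrable[OF rv(1) fi(1)]
      square_integrable_imp_integrable[OF rv(2) IH(1)] by auto
  have ip: "integrable M (\<lambda>w. f i w * ?S w)"
    by (rule indep_var_integrable[OF ind i1])
  have "expectation (\<lambda>w. f i w * ?S w) = 0"
    using indep_var_lebesgue_integral[OF ind i1] fi by simp
  moreover have eq: "(\<Sum>j\<in>insert i I. f j w)\<^sup>2 = (f i w)\<^sup>2 + 2 * (f i w * ?S w) + (?S w)\<^sup>2" for w
    using insert by (simp add: power2_sum)
  ultimately show ?case
    unfolding eq using fi IH ip insert by simp
qed simp

lemma integrable_mult_of_squares:
  fixes f g :: "'a \<Rightarrow> real"
  assumes [measurable]: "f \<in> borel_measurable M" "g \<in> borel_measurable M"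
    and "integrable M (\<lambda>x. (f x)\<^sup>2)" "integrable M (\<lambda>x. (g x)\<^sup>2)"
  shows "integrable M (\<lambda>x. f x * g x)"
proof (rule Bochner_Integration.integrable_bound)
  show "integrable M (\<lambda>x. (f x)\<^sup>2 + (g x)\<^sup>2)" using assms by simp
  have "\<bar>a * b\<bar> \<le> a\<^sup>2 + b\<^sup>2" for a b :: real
  proof -
    have "2 * (\<bar>a\<bar> * \<bar>b\<bar>) \<le> a\<^sup>2 + b\<^sup>2"
      using zero_le_power2[of "\<bar>a\<bar> - \<bar>b\<bar>"] by (simp add: power2_diff)
    moreover have "0 \<le> \<bar>a\<bar> * \<bar>b\<bar>" by simp
    ultimately show ?thesis unfolding abs_mult by linarith
  qed
  then show "AE x in M. norm (f x * g x) \<le> norm ((f x)\<^sup>2 + (g x)\<^sup>2)" by simp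
qed simp

lemma integral_cauchy_schwarz:
  fixes f g :: "'a \<Rightarrow> real"
  assumes "f \<in> borel_measurable M" "g \<in> borel_measurable M"
    and "integrable M (\<lambda>x. (f x)\<^sup>2)" "integrable M (\<lambda>x. (g x)\<^sup>2)"
  shows "(\<integral>x. f x * g x \<partial>M)\<^sup>2 \<le> (\<integral>x. (f x)\<^sup>2 \<partial>M) * (\<integral>x. (g x)\<^sup>2 \<partial>M)"
proof -
  let ?a = "\<integral>x. (f x)\<^sup>2 \<partial>M" and ?b = "\<integral>x. f x * g x \<partial>M" and ?c = "\<integral>x. (g x)\<^sup>2 \<partial>M"
  have fg: "integrable M (\<lambda>x. f x * g x)"
    by (rule integrable_mult_of_squares[OF assms])
  have nonneg: "0 \<le> ?a * s\<^sup>2 - 2 * ?b * s * r + ?c * r\<^sup>2" for s r :: real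
  proof -
    define c where "c = 2 * s * r"
    have "0 \<le> (\<integral>x. (s * f x - r * g x)\<^sup>2 \<partial>M)" by simp
    also have "(\<integral>x. (s * f x - r * g x)\<^sup>2 \<partial>M) =
        (\<integral>x. s\<^sup>2 * (f x)\<^sup>2 - c * (f x * g x) + r\<^sup>2 * (g x)\<^sup>2 \<partial>M)"
      by (rule Bochner_Integration.integral_cong) (auto simp: c_def power2_eq_square algebra_simps)
    also have "\<dots> = s\<^sup>2 * ?a - c * ?b + r\<^sup>2 * ?c"
      using assms fg by simp
    also have "\<dots> = ?a * s\<^sup>2 - 2 * ?b * s * r + ?c * r\<^sup>2"
      by (simp add: c_def)
    finally show ?thesis .
  qed
  show ?thesis
  proof (cases "?a = 0")
    case True
    have "?b = 0"
    proof (rule ccontr)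
      assume "?b \<noteq> 0"
      \<comment> \<open>For \<open>?a = 0\<close> the quadratic form is linear in \<open>s\<close>;
        this choice gives it the value -1.\<close>
      with nonneg[of "(?c + 1) / (2 * ?b)" 1] True show False by simp
    qed
    then show ?thesis using True by simp
  next
    case False
    moreover have "?a \<ge> 0" by simp
    ultimately have "?a > 0" by linarith
    \<comment> \<open>At \<open>s = ?b\<close> and \<open>r = ?a\<close> the form equals
      \<open>?a * (?a * ?c - ?b\<^sup>2)\<close>, and the positive factor \<open>?a\<close> can be
      cancelled.\<close>
    moreover have "0 \<le> ?a * (?a * ?c - ?b\<^sup>2)"
      using nonneg[of ?b ?a] by (simp add: power2_eq_square algebra_simps)
    ultimately show ?thesis by (simp add: zero_le_mult_iff)
  qed
qed

section \<open>Functions of the covariate\<close>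

lemma integrable_X_marginal:
  fixes f :: "'x \<Rightarrow> real"
  assumes "f \<in> borel_measurable SX" "fst \<in> measurable P SX"
  shows "integrable (X_marginal SX P) f \<longleftrightarrow> integrable P (\<lambda>z. f (fst z))"
    and "(\<integral>x. f x \<partial>X_marginal SX P) = (\<integral>z. f (fst z) \<partial>P)"
  using assms by (simp_all add: X_marginal_def integrable_distr_eq integral_distr)

text \<open>Moments are computed under the joint law \<open>P\<close>, so the moment conditions are
  moved there. Measurability stays a condition on \<open>SX\<close>, since it cannot be read off
  from the composition with \<open>fst\<close>.\<close>

lemma influence_function_X_marginal:
  assumes fst: "fst \<in> measurable P SX"
  shows "influence_function (X_marginal SX P) f \<longleftrightarrow>
    f \<in> borel_measurable SX \<and> integrable P (\<lambda>z. (f (fst z))\<^sup>2) \<and> (\<integral>z. f (fst z) \<partial>P) = 0"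
proof (cases "f \<in> borel_measurable SX")
  case True
  then have "(\<lambda>x. (f x)\<^sup>2) \<in> borel_measurable SX" by simp
  with True show ?thesis
    unfolding influence_function_def
    by (simp add: integrable_X_marginal[OF _ fst]) (simp add: X_marginal_def)
qed (simp add: influence_function_def X_marginal_def)

text \<open>This is the Doob-Dynkin lemma: every level set of \<open>f\<close> is a preimage under
  \<open>T\<close>, so \<open>f\<close> can be rebuilt from countably many sets in \<open>S\<close>.
  It provides a regression function without disintegrating \<open>P\<close>.\<close>

lemma measurable_vimage_algebra_factor:
  fixes f :: "'a \<Rightarrow> real"
  assumes T: "T \<in> \<Omega> \<rightarrow> space S" and f: "f \<in> borel_measurable (vimage_algebra \<Omega> T S)"
  obtains h where "h \<in> borel_measurable S" "\<And>z. z \<in> \<Omega> \<Longrightarrow> h (T z) = f z"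
proof -
  have "\<exists>A\<in>sets S. {z \<in> \<Omega>. f z < q} = T -` A \<inter> \<Omega>" for q
  proof -
    have "{z \<in> \<Omega>. f z < q} \<in> sets (vimage_algebra \<Omega> T S)"
      using f[THEN borel_measurable_less, of "\<lambda>_. q"] by simp
    then show ?thesis by (auto simp: sets_vimage_algebra2[OF T])
  qed
  then obtain A where A: "\<And>q. A q \<in> sets S" "\<And>q. {z \<in> \<Omega>. f z < q} = T -` A q \<inter> \<Omega>"
    by metis
  \<comment> \<open>\<open>f z\<close> is the infimum of the rationals \<open>q > f z\<close>, and \<open>f z < q\<close> only depends on \<open>T z\<close>.\<close>
  define h where "h x = (INF q\<in>\<rat>. if x \<in> A q then ereal q else \<infinity>)" for x
  have [measurable]: "A q \<in> sets S" for q by (rule A)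
  have "h \<in> borel_measurable S"
    unfolding h_def by (intro borel_measurable_INF countable_rat measurable_If) auto
  then have "(\<lambda>x. real_of_ereal (h x)) \<in> borel_measurable S" by simp
  moreover have "real_of_ereal (h (T z)) = f z" if z: "z \<in> \<Omega>" for z
  proof -
    have mem: "T z \<in> A q \<longleftrightarrow> f z < q" for q
      using A(2)[of q] z by auto
    have "h (T z) = ereal (f z)"
    proof (rule antisym)
      show "h (T z) \<le> ereal (f z)"
      proof (rule ereal_le_epsilon2)
        fix e :: real assume "0 < e"
        then obtain q where q: "q \<in> \<rat>" "f z < q" "q < f z + e"
          using Rats_dense_in_real[of "f z" "f z + e"] by auto
        have "h (T z) \<le> (if T z \<in> A q then ereal q else \<infinity>)"
          unfolding h_def by (rule INF_lower) (rule q)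
        also have "\<dots> \<le> ereal (f z) + ereal e"
          using q by (simp add: mem)
        finally show "h (T z) \<le> ereal (f z) + ereal e" .
      qed
      show "ereal (f z) \<le> h (T z)"
        unfolding h_def by (rule INF_greatest) (auto simp: mem)
    qed
    then show ?thesis by simp
  qed
  ultimately show ?thesis by (rule that)
qed

section \<open>The variance as a quadratic in the weight\<close>

text \<open>The vertex of the parabola is substituted. In the two degenerate cases division by 0
  yields 0, and both sides reduce to the second moment of \<open>\<phi>\<close>.\<close>

lemma asymp_var_omega_opt:
  "asymp_var P \<phi> lam \<psi> (omega_opt P \<phi> \<psi>) =
    (\<integral>z. (\<phi> z)\<^sup>2 \<partial>P) - (\<integral>z. \<phi> z * \<psi> (fst z) \<partial>P)\<^sup>2 / ((1 + lam) * (\<integral>z. (\<psi> (fst z))\<^sup>2 \<partial>P))"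
  by (cases "1 + lam = 0"; cases "(\<integral>z. (\<psi> (fst z))\<^sup>2 \<partial>P) = 0")
     (simp_all add: asymp_var_def omega_opt_def power2_eq_square divide_simps)

text \<open>Completing the square: with \<open>a\<close> the second moment of \<open>\<psi>\<close>
  and \<open>b\<close> its mixed moment with \<open>\<phi>\<close>, the excess at \<open>c\<close>
  is \<open>a * (c - b / a)\<^sup>2 / (1 + lam)\<close>. Assumption \<open>cs\<close> serves the
  case \<open>a = 0\<close>, where it forces \<open>b = 0\<close> and the variance is constant in
  \<open>c\<close>.\<close>

lemma asymp_var_omega_opt_le:
  assumes lam: "lam \<ge> 0"
    and cs: "(\<integral>z. \<phi> z * \<psi> (fst z) \<partial>P)\<^sup>2 \<le> K * (\<integral>z. (\<psi> (fst z))\<^sup>2 \<partial>P)"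
  shows "asymp_var P \<phi> lam \<psi> (omega_opt P \<phi> \<psi>) \<le> asymp_var P \<phi> lam \<psi> c"
proof -
  define a b where "a = (\<integral>z. (\<psi> (fst z))\<^sup>2 \<partial>P)" and "b = (\<integral>z. \<phi> z * \<psi> (fst z) \<partial>P)"
  have a: "a \<ge> 0" unfolding a_def by simp
  have b0: "b = 0" if "a = 0" using cs that unfolding a_def b_def by simp
  have "asymp_var P \<phi> lam \<psi> c - asymp_var P \<phi> lam \<psi> (omega_opt P \<phi> \<psi>) = a * (c - b / a)\<^sup>2 / (1 + lam)"
    using lam b0 unfolding asymp_var_omega_opt unfolding asymp_var_def a_def[symmetric] b_def[symmetric]
    by (cases "a = 0") (simp_all add: power2_eq_square divide_simps, algebra)
  also have "\<dots> \<ge> 0" using a lam by simp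
  finally show ?thesis by simp
qed

section \<open>The regression function\<close>

text \<open>Averaging the conditional expectation gives mean 0, and conditional Jensen for the
  square gives a finite second moment. A factor \<open>f (fst z)\<close> is measurable for the
  sigma-algebra generated by the covariate, so it passes through the conditional
  expectation.\<close>

lemma regression_version_properties:
  assumes P: "prob_space P" and fst: "fst \<in> measurable P SX"
    and infl: "influence_function P \<phi>"
    and h: "regression_version SX P \<phi> h"
  shows "influence_function (X_marginal SX P) h"
    and "prob_space.variance P (cond_exp_given_X SX P \<phi>) = (\<integral>z. (h (fst z))\<^sup>2 \<partial>P)"
    and "influence_function (X_marginal SX P) f \<Longrightarrow>
      (\<integral>z. \<phi> z * f (fst z) \<partial>P) = (\<integral>z. h (fst z) * f (fst z) \<partial>P)"
proof -
  interpret prob_space P by fact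
  define F where "F = vimage_algebra (space P) fst SX"
  have fstF: "fst \<in> measurable F SX"
    unfolding F_def using measurable_space[OF fst] by (intro measurable_vimage_algebra1) auto
  interpret finite_measure_subalgebra P F
  proof
    show "subalgebra P F"
      unfolding subalgebra_def F_def using sets_image_in_sets[OF refl fst] by simp
  qed
  have \<phi>: "\<phi> \<in> borel_measurable P" "integrable P (\<lambda>z. (\<phi> z)\<^sup>2)" "expectation \<phi> = 0"
    using infl by (auto simp: influence_function_def)
  have \<phi>1: "integrable P \<phi>"
    by (rule square_integrable_imp_integrable[OF \<phi>(1,2)])
  have h_meas: "h \<in> borel_measurable SX"
    and ce: "AE z in P. h (fst z) = real_cond_exp P F \<phi> z"
    using h by (auto simp: regression_version_def cond_exp_given_X_def F_def)
  have hP: "(\<lambda>z. h (fst z)) \<in> borel_measurable P"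
    using fst h_meas by (rule measurable_compose)
  have mean: "(\<integral>z. real_cond_exp P F \<phi> z \<partial>P) = 0"
    using real_cond_exp_int(2)[OF \<phi>1] \<phi>(3) by simp
  have "AE z in P. (real_cond_exp P F \<phi> z)\<^sup>2 \<le> real_cond_exp P F (\<lambda>z. (\<phi> z)\<^sup>2) z"
    by (rule real_cond_exp_jensens_inequality(2)[OF \<phi>1, of UNIV])
       (use \<phi>(2) in \<open>auto simp: convex_power2\<close>)
  then have sq: "integrable P (\<lambda>z. (real_cond_exp P F \<phi> z)\<^sup>2)"
    by (intro Bochner_Integration.integrable_bound[OF real_cond_exp_int(1)[OF \<phi>(2)]])
       (auto elim!: eventually_mono)
  have sqh: "integrable P (\<lambda>z. (h (fst z))\<^sup>2)"
    using sq by (rule integrable_cong_AE_imp) (use hP ce in auto)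
  have "(\<integral>z. h (fst z) \<partial>P) = 0"
    using integral_cong_AE[of "\<lambda>z. h (fst z)" P "real_cond_exp P F \<phi>"] hP ce mean by simp
  then show "influence_function (X_marginal SX P) h"
    using h_meas sqh by (simp add: influence_function_X_marginal[OF fst])
  have "(\<integral>z. (real_cond_exp P F \<phi> z)\<^sup>2 \<partial>P) = (\<integral>z. (h (fst z))\<^sup>2 \<partial>P)"
    by (rule integral_cong_AE) (use hP ce in auto)
  then show "variance (cond_exp_given_X SX P \<phi>) = (\<integral>z. (h (fst z))\<^sup>2 \<partial>P)"
    unfolding cond_exp_given_X_def F_def[symmetric] by (simp add: mean)
  assume "influence_function (X_marginal SX P) f"
  then have f: "f \<in> borel_measurable SX" "integrable P (\<lambda>z. (f (fst z))\<^sup>2)"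
    by (auto simp: influence_function_X_marginal[OF fst])
  have fF: "(\<lambda>z. f (fst z)) \<in> borel_measurable F"
    using fstF f(1) by (rule measurable_compose)
  have fP: "(\<lambda>z. f (fst z)) \<in> borel_measurable P"
    using fst f(1) by (rule measurable_compose)
  have "(\<integral>z. f (fst z) * real_cond_exp P F \<phi> z \<partial>P) = (\<integral>z. f (fst z) * \<phi> z \<partial>P)"
    by (rule real_cond_exp_intg(2)[OF integrable_mult_of_squares[OF fP \<phi>(1) f(2) \<phi>(2)] fF \<phi>(1)])
  moreover have "(\<integral>z. h (fst z) * f (fst z) \<partial>P) = (\<integral>z. f (fst z) * real_cond_exp P F \<phi> z \<partial>P)"
    by (rule integral_cong_AE) (use hP fP ce in auto)
  ultimately show "(\<integral>z. \<phi> z * f (fst z) \<partial>P) = (\<integral>z. h (fst z) * f (fst z) \<partial>P)"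
    by (simp add: mult.commute)
qed

text \<open>The conditional expectation is measurable for the sigma-algebra generated by
  \<open>fst\<close>, hence it factors through \<open>fst\<close>.\<close>

lemma regression_version_exists:
  assumes fst: "fst \<in> measurable P SX"
  shows "\<exists>h. regression_version SX P \<phi> h"
proof -
  have "fst \<in> space P \<rightarrow> space SX"
    using measurable_space[OF fst] by auto
  from measurable_vimage_algebra_factor[OF this borel_measurable_cond_exp]
  obtain h where "h \<in> borel_measurable SX"
    "\<And>z. z \<in> space P \<Longrightarrow> h (fst z) = cond_exp_given_X SX P \<phi> z"
    unfolding cond_exp_given_X_def by blast
  then show ?thesis
    unfolding regression_version_def by (intro exI[of _ h]) auto
qed

section \<open>Normalized sums in the semisupervised sample\<close>

lemma (in prob_space) char_normalized_iid_sum: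
  assumes ind: "indep_vars (\<lambda>_. borel) f I" and distr: "\<And>i. i \<in> I \<Longrightarrow> distr M borel (f i) = \<mu>"
  shows "char (distr M borel (\<lambda>w. (\<Sum>i\<in>I. f i w) / c)) t = char \<mu> (t / c) ^ card I"
proof -
  have [measurable]: "f i \<in> borel_measurable M" if "i \<in> I" for i
    using ind that by (auto simp: indep_vars_def2)
  have "char (distr M borel (\<lambda>w. (\<Sum>i\<in>I. f i w) / c)) t = char (distr M borel (\<lambda>w. \<Sum>i\<in>I. f i w)) (t / c)"
    by (simp add: char_def integral_distr)
  also have "\<dots> = (\<Prod>i\<in>I. char (distr M borel (f i)) (t / c))"
    by (rule char_distr_sum[OF ind])
  finally show ?thesis by (simp add: distr)
qed

text \<open>Scaling by the root of the sample size bounds second moments uniformly in that size.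
  This is the tightness required when such a sum is multiplied by a vanishing weight error.\<close>

lemma (in prob_space) second_moment_normalized_iid_sum:
  fixes f :: "'i \<Rightarrow> 'a \<Rightarrow> real"
  assumes "finite I" and ind: "indep_vars (\<lambda>_. borel) f I"
    and distr: "\<And>i. i \<in> I \<Longrightarrow> distr M borel (f i) = distr Q borel g"
    and g: "influence_function Q g"
  shows "integrable M (\<lambda>w. ((\<Sum>i\<in>I. f i w) / sqrt (real (card I)))\<^sup>2)"
    and "expectation (\<lambda>w. ((\<Sum>i\<in>I. f i w) / sqrt (real (card I)))\<^sup>2) \<le> (\<integral>z. (g z)\<^sup>2 \<partial>Q)"
proof -
  have f: "f i \<in> borel_measurable M" if "i \<in> I" for i
    using ind that by (auto simp: indep_vars_def2)
  have gm: "g \<in> borel_measurable Q" "integrable Q (\<lambda>z. (g z)\<^sup>2)" "(\<integral>z. g z \<partial>Q) = 0"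
    using g by (auto simp: influence_function_def)
  have sq: "integrable M (\<lambda>w. (f i w)\<^sup>2)" "expectation (\<lambda>w. (f i w)\<^sup>2) = (\<integral>z. (g z)\<^sup>2 \<partial>Q)"
    "expectation (f i) = 0" if i: "i \<in> I" for i
  proof -
    note d = distr[OF i]
    have "integrable (distr M borel (f i)) (\<lambda>x. x\<^sup>2)"
      unfolding d using gm by (simp add: integrable_distr_eq)
    then show "integrable M (\<lambda>w. (f i w)\<^sup>2)"
      using f[OF i] by (simp add: integrable_distr_eq)
    have "(\<integral>x. x\<^sup>2 \<partial>distr M borel (f i)) = (\<integral>x. x\<^sup>2 \<partial>distr Q borel g)" by (simp add: d)
    then show "expectation (\<lambda>w. (f i w)\<^sup>2) = (\<integral>z. (g z)\<^sup>2 \<partial>Q)"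
      using f[OF i] gm by (simp add: integral_distr)
    have "(\<integral>x. x \<partial>distr M borel (f i)) = (\<integral>x. x \<partial>distr Q borel g)" by (simp add: d)
    then show "expectation (f i) = 0"
      using f[OF i] gm by (simp add: integral_distr)
  qed
  have sum: "integrable M (\<lambda>w. (\<Sum>i\<in>I. f i w)\<^sup>2)"
    "expectation (\<lambda>w. (\<Sum>i\<in>I. f i w)\<^sup>2) = real (card I) * (\<integral>z. (g z)\<^sup>2 \<partial>Q)"
    using second_moment_sum_indep[OF \<open>finite I\<close> ind sq(1,3)] by (auto simp: sq(2))
  have eq: "((\<Sum>i\<in>I. f i w) / sqrt (real (card I)))\<^sup>2 = (\<Sum>i\<in>I. f i w)\<^sup>2 / real (card I)" for w
    by (simp add: power_divide)
  show "integrable M (\<lambda>w. ((\<Sum>i\<in>I. f i w) / sqrt (real (card I)))\<^sup>2)"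
    unfolding eq using sum by simp
  \<comment> \<open>An inequality and not an equality, because for an empty \<open>I\<close> the
    left side is 0.\<close>
  show "expectation (\<lambda>w. ((\<Sum>i\<in>I. f i w) / sqrt (real (card I)))\<^sup>2) \<le> (\<integral>z. (g z)\<^sup>2 \<partial>Q)"
    unfolding eq using sum by (cases "card I = 0") auto
qed

lemma sigma_sets_comp_subset_vimage_algebra:
  assumes D: "D \<in> measurable M S" and f: "f \<in> measurable S A"
  shows "sigma_sets (space M) {(\<lambda>w. f (D w)) -` B \<inter> space M | B. B \<in> sets A}
    \<subseteq> sets (vimage_algebra (space M) D S)"
proof -
  have "D \<in> measurable (vimage_algebra (space M) D S) S"
    using measurable_space[OF D] by (intro measurable_vimage_algebra1) auto
  then have comp: "(\<lambda>w. f (D w)) \<in> measurable (vimage_algebra (space M) D S) A"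
    using f by (rule measurable_compose)
  have "{(\<lambda>w. f (D w)) -` B \<inter> space M | B. B \<in> sets A} \<subseteq> sets (vimage_algebra (space M) D S)"
    using measurable_sets[OF comp] by (auto simp only: space_vimage_algebra)
  from sets.sigma_sets_subset[OF this] show ?thesis by simp
qed

text \<open>A measurable function of a data block generates a sub-sigma-algebra of the one generated
  by the block, so independence of the blocks is inherited.\<close>

lemma (in prob_space) indep_var_if_indep_set_vimage_algebra:
  assumes ind: "indep_set (sets (vimage_algebra (space M) D S)) (sets (vimage_algebra (space M) E T))"
    and D: "D \<in> measurable M S" and E: "E \<in> measurable M T"
    and f: "f \<in> measurable S A" and g: "g \<in> measurable T B"
  shows "indep_var A (\<lambda>w. f (D w)) B (\<lambda>w. g (E w))"
  unfolding indep_var_eq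
proof (intro conjI)
  show "indep_set
      (sigma_sets (space M) {(\<lambda>w. f (D w)) -` C \<inter> space M | C. C \<in> sets A})
      (sigma_sets (space M) {(\<lambda>w. g (E w)) -` C \<inter> space M | C. C \<in> sets B})"
    using ind unfolding indep_set_def
    by (rule indep_sets_mono_sets)
       (simp split: bool.split add: sigma_sets_comp_subset_vimage_algebra[OF D f]
         sigma_sets_comp_subset_vimage_algebra[OF E g])
qed (use measurable_compose[OF D f] measurable_compose[OF E g] in simp_all)

text \<open>Collects what the limit argument takes from the sampling scheme. Only the last item
  draws on the independence between the labeled and the unlabeled block.\<close>

lemma semisupervised_sampleD:
  fixes g :: "'x \<times> 'y \<Rightarrow> real" and h :: "'x \<Rightarrow> real"
  assumes sample: "semisupervised_sample M SX SY P X Y n N"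
    and setsP: "sets P = sets (SX \<Otimes>\<^sub>M SY)"
    and g: "g \<in> borel_measurable P" and h: "h \<in> borel_measurable SX"
  shows "prob_space M"
    and "i < n \<Longrightarrow> (\<lambda>w. (X i w, Y i w)) \<in> measurable M (SX \<Otimes>\<^sub>M SY)"
    and "i < n + N \<Longrightarrow> X i \<in> measurable M SX"
    and "prob_space.indep_vars M (\<lambda>_. borel) (\<lambda>i w. g (X i w, Y i w)) {..<n}"
    and "i < n \<Longrightarrow> distr M borel (\<lambda>w. g (X i w, Y i w)) = distr P borel g"
    and "prob_space.indep_vars M (\<lambda>_. borel) (\<lambda>i w. h (X i w)) {n..<n + N}"
    and "i \<in> {n..<n + N} \<Longrightarrow> distr M borel (\<lambda>w. h (X i w)) = distr (X_marginal SX P) borel h"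
    and "prob_space.indep_var M borel (\<lambda>w. \<Sum>i<n. g (X i w, Y i w)) borel (\<lambda>w. \<Sum>i\<in>{n..<n + N}. h (X i w))"
proof -
  show "prob_space M" using sample by (simp add: semisupervised_sample_def)
  then interpret prob_space M .
  have lab: "indep_vars (\<lambda>_. SX \<Otimes>\<^sub>M SY) (\<lambda>i w. (X i w, Y i w)) {..<n}"
    "\<And>i. i < n \<Longrightarrow> distr M (SX \<Otimes>\<^sub>M SY) (\<lambda>w. (X i w, Y i w)) = P"
    and unl: "indep_vars (\<lambda>_. SX) X {n..<n + N}"
    "\<And>i. i \<in> {n..<n + N} \<Longrightarrow> distr M SX (X i) = X_marginal SX P"
    and ind: "indep_set
       (sets (vimage_algebra (space M) (labeled_data X Y {..<n}) (Pi\<^sub>M {..<n} (\<lambda>_. SX \<Otimes>\<^sub>M SY))))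
       (sets (vimage_algebra (space M) (covariate_data X {n..<n + N}) (Pi\<^sub>M {n..<n + N} (\<lambda>_. SX))))"
    using sample by (auto simp: semisupervised_sample_def)
  have g'[measurable]: "g \<in> borel_measurable (SX \<Otimes>\<^sub>M SY)"
    using g setsP by (simp cong: measurable_cong_sets)
  have XY: "(\<lambda>w. (X i w, Y i w)) \<in> measurable M (SX \<Otimes>\<^sub>M SY)" if "i < n" for i
    using lab(1) that by (simp add: indep_vars_def2)
  then show "i < n \<Longrightarrow> (\<lambda>w. (X i w, Y i w)) \<in> measurable M (SX \<Otimes>\<^sub>M SY)" .
  have Xu: "X i \<in> measurable M SX" if "i \<in> {n..<n + N}" for i
    using unl(1) that by (simp add: indep_vars_def2)
  have Xl: "X i \<in> measurable M SX" if "i < n" for i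
    using measurable_compose[OF XY[OF that] measurable_fst] by simp
  show "i < n + N \<Longrightarrow> X i \<in> measurable M SX"
    using Xl Xu by (cases "i < n") auto
  show "indep_vars (\<lambda>_. borel) (\<lambda>i w. g (X i w, Y i w)) {..<n}"
    by (rule indep_vars_compose2[OF lab(1)]) (rule g')
  show "distr M borel (\<lambda>w. g (X i w, Y i w)) = distr P borel g" if "i < n"
    unfolding lab(2)[OF that, symmetric] using distr_distr[OF g' XY[OF that]] by (simp add: comp_def)
  show "indep_vars (\<lambda>_. borel) (\<lambda>i w. h (X i w)) {n..<n + N}"
    by (rule indep_vars_compose2[OF unl(1)]) (rule h)
  show "distr M borel (\<lambda>w. h (X i w)) = distr (X_marginal SX P) borel h" if "i \<in> {n..<n + N}"
    unfolding unl(2)[OF that, symmetric] using distr_distr[OF h Xu[OF that]] by (simp add: comp_def)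
  have "labeled_data X Y {..<n} \<in> measurable M (Pi\<^sub>M {..<n} (\<lambda>_. SX \<Otimes>\<^sub>M SY))"
    unfolding labeled_data_def by (rule measurable_restrict) (use XY in auto)
  moreover have "covariate_data X {n..<n + N} \<in> measurable M (Pi\<^sub>M {n..<n + N} (\<lambda>_. SX))"
    unfolding covariate_data_def by (rule measurable_restrict) (rule Xu)
  moreover have "(\<lambda>d. \<Sum>i<n. g (d i)) \<in> borel_measurable (Pi\<^sub>M {..<n} (\<lambda>_. SX \<Otimes>\<^sub>M SY))"
    by measurable
  moreover have "(\<lambda>d. \<Sum>i\<in>{n..<n + N}. h (d i)) \<in> borel_measurable (Pi\<^sub>M {n..<n + N} (\<lambda>_. SX))"
    using h by measurable
  ultimately have "indep_var borel (\<lambda>w. \<Sum>i<n. g (labeled_data X Y {..<n} w i))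
      borel (\<lambda>w. \<Sum>i\<in>{n..<n + N}. h (covariate_data X {n..<n + N} w i))"
    by (rule indep_var_if_indep_set_vimage_algebra[OF ind])
  then show "indep_var borel (\<lambda>w. \<Sum>i<n. g (X i w, Y i w)) borel (\<lambda>w. \<Sum>i\<in>{n..<n + N}. h (X i w))"
    by (simp add: labeled_data_def covariate_data_def)
qed

lemma influence_function_char_power:
  assumes "prob_space Q" and g: "influence_function Q g" and m: "filterlim m at_top sequentially"
  shows "(\<lambda>k. char (distr Q borel g) (t / sqrt (real (m k))) ^ m k)
    \<longlonglongrightarrow> exp (- ((\<integral>z. (g z)\<^sup>2 \<partial>Q) * t\<^sup>2 / 2))"
proof -
  interpret prob_space Q by fact
  have gm: "g \<in> borel_measurable Q" "integrable Q (\<lambda>z. (g z)\<^sup>2)" "(\<integral>z. g z \<partial>Q) = 0"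
    using g by (auto simp: influence_function_def)
  interpret D: real_distribution "distr Q borel g"
    using gm by simp
  have "(\<lambda>n. char (distr Q borel g) (t / sqrt (real n)) ^ n)
    \<longlonglongrightarrow> exp (- ((\<integral>x. x\<^sup>2 \<partial>distr Q borel g) * t\<^sup>2 / 2))"
    by (rule D.char_power_tendsto_gaussian) (use gm in \<open>simp_all add: integrable_distr_eq integral_distr\<close>)
  from filterlim_compose[OF this m] show ?thesis
    using gm by (simp add: integral_distr)
qed

text \<open>For every \<open>k\<close>, independence factors the characteristic function into two
  powers, one per block; each has a Gaussian limit, and the exponents add. Since \<open>g\<close>
  and \<open>h\<close> do not depend on \<open>k\<close>, the one-sample limit applies along
  \<open>n k\<close> and \<open>N k\<close>.\<close>

lemma semisupervised_char_limit:
  fixes M :: "nat \<Rightarrow> 'w measure"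
  assumes P: "prob_space P" "sets P = sets (SX \<Otimes>\<^sub>M SY)"
    and sample: "\<And>k. semisupervised_sample (M k) SX SY P (X k) (Y k) (n k) (N k)"
    and sizes: "filterlim n at_top sequentially" "filterlim N at_top sequentially"
    and g: "influence_function P g" and h: "influence_function (X_marginal SX P) h"
  shows "(\<lambda>k. char (distr (M k) borel (\<lambda>w. (\<Sum>i<n k. g (X k i w, Y k i w)) / sqrt (real (n k)) +
      (\<Sum>i\<in>{n k..<n k + N k}. h (X k i w)) / sqrt (real (N k)))) t)
    \<longlonglongrightarrow> exp (- (((\<integral>z. (g z)\<^sup>2 \<partial>P) + (\<integral>x. (h x)\<^sup>2 \<partial>X_marginal SX P)) * t\<^sup>2 / 2))"
proof -
  have gm: "g \<in> borel_measurable P" and hm: "h \<in> borel_measurable SX"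
    using g h by (auto simp: influence_function_def X_marginal_def)
  have fst: "fst \<in> measurable P SX"
    using measurable_fst[of SX SY] P(2) by (simp cong: measurable_cong_sets)
  have Q: "prob_space (X_marginal SX P)"
    unfolding X_marginal_def by (rule prob_space.prob_space_distr[OF P(1) fst])
  have char: "char (distr (M k) borel (\<lambda>w. (\<Sum>i<n k. g (X k i w, Y k i w)) / sqrt (real (n k)) +
      (\<Sum>i\<in>{n k..<n k + N k}. h (X k i w)) / sqrt (real (N k)))) t =
    char (distr P borel g) (t / sqrt (real (n k))) ^ n k *
    char (distr (X_marginal SX P) borel h) (t / sqrt (real (N k))) ^ N k" for k
  proof -
    note D = semisupervised_sampleD[OF sample[of k] P(2) gm hm]
    interpret prob_space "M k" by (rule D)
    have "indep_var borel ((\<lambda>x. x / sqrt (real (n k))) \<circ> (\<lambda>w. \<Sum>i<n k. g (X k i w, Y k i w)))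
        borel ((\<lambda>x. x / sqrt (real (N k))) \<circ> (\<lambda>w. \<Sum>i\<in>{n k..<n k + N k}. h (X k i w)))"
      by (rule indep_var_compose[OF D(8)]) simp_all
    from char_distr_add[OF this[unfolded comp_def], of t] show ?thesis
      using char_normalized_iid_sum[OF D(4) D(5), of "sqrt (real (n k))" t]
        char_normalized_iid_sum[OF D(6) D(7), of "sqrt (real (N k))" t] by simp
  qed
  let ?a = "\<integral>z. (g z)\<^sup>2 \<partial>P" and ?b = "\<integral>x. (h x)\<^sup>2 \<partial>X_marginal SX P"
  have "exp (- (?a * t\<^sup>2 / 2)) * exp (- (?b * t\<^sup>2 / 2)) = exp (- ((?a + ?b) * t\<^sup>2 / 2))"
    unfolding exp_add[symmetric] by (simp add: distrib_right add_divide_distrib)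
  then show ?thesis
    unfolding char
    using tendsto_mult[OF influence_function_char_power[OF P(1) g sizes(1), of t]
        influence_function_char_power[OF Q h sizes(2), of t]]
    by (simp only: of_real_mult[symmetric])
qed

section \<open>Algebra of the rectification term\<close>

text \<open>As soon as \<open>N k > 0\<close>, both weights are functions of the ratio
  \<open>n k / N k\<close> alone, and these functions converge along it. The case
  \<open>lam = 0\<close> is included.\<close>

lemma rectification_weights:
  fixes n N :: "nat \<Rightarrow> nat"
  assumes N: "filterlim N at_top sequentially"
    and ratio: "(\<lambda>k. real (n k) / real (N k)) \<longlonglongrightarrow> lam"
  shows "lam \<ge> 0"
    and "(\<lambda>k. real (N k) / real (n k + N k)) \<longlonglongrightarrow> 1 / (1 + lam)"
    and "(\<lambda>k. sqrt (real (n k)) * sqrt (real (N k)) / real (n k + N k)) \<longlonglongrightarrow> sqrt lam / (1 + lam)"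
proof -
  show lam: "lam \<ge> 0"
    by (rule LIMSEQ_le_const[OF ratio]) simp
  have ev: "eventually (\<lambda>k. N k > 0) sequentially"
    using N[unfolded filterlim_at_top, rule_format, of 1] by (auto elim!: eventually_mono)
  have "(\<lambda>k. 1 / (1 + real (n k) / real (N k))) \<longlonglongrightarrow> 1 / (1 + lam)"
    using lam by (intro tendsto_intros ratio) auto
  then show "(\<lambda>k. real (N k) / real (n k + N k)) \<longlonglongrightarrow> 1 / (1 + lam)"
    by (rule Lim_transform_eventually) (use ev in \<open>auto elim!: eventually_mono simp: field_simps\<close>)
  have lim: "(\<lambda>k. sqrt (real (n k) / real (N k)) / (1 + real (n k) / real (N k))) \<longlonglongrightarrow> sqrt lam / (1 + lam)"
    using lam by (intro tendsto_intros ratio) auto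
  have eq: "sqrt (a / b) / (1 + a / b) = sqrt a * sqrt b / (a + b)" if "b > 0" for a b :: real
  proof -
    have "1 + a / b = (a + b) / b"
      using that by (simp add: field_simps)
    then have "sqrt (a / b) / (1 + a / b) = sqrt a * (b / sqrt b) / (a + b)"
      by (simp add: real_sqrt_divide)
    then show ?thesis using that by (simp add: real_div_sqrt)
  qed
  show "(\<lambda>k. sqrt (real (n k)) * sqrt (real (N k)) / real (n k + N k)) \<longlonglongrightarrow> sqrt lam / (1 + lam)"
    by (rule Lim_transform_eventually[OF lim], rule eventually_mono[OF ev]) (simp add: eq)
qed

text \<open>The labeled sum \<open>u\<close> occurs in both means, with net coefficient
  \<open>1 / (n + N) - 1 / n = - N / (n * (n + N))\<close>; hence the minus sign. Empty blocks have
  sum 0, so the identity is exact at every stage.\<close>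

lemma pooled_minus_labeled_mean:
  fixes u v :: real and n N :: nat
  assumes "n = 0 \<Longrightarrow> u = 0" "N = 0 \<Longrightarrow> v = 0"
  shows "sqrt (real n) * ((u + v) / real (n + N) - u / real n) =
    - (real N / real (n + N)) * (u / sqrt (real n))
    + (sqrt (real n) * sqrt (real N) / real (n + N)) * (v / sqrt (real N))"
proof (cases "n = 0 \<or> N = 0")
  case True
  then show ?thesis using assms by auto
next
  case False
  define a b where "a = sqrt (real n)" and "b = sqrt (real N)"
  have ab: "a > 0" "b > 0" "real n = a\<^sup>2" "real N = b\<^sup>2"
    using False by (auto simp: a_def b_def)
  have "a\<^sup>2 + b\<^sup>2 \<noteq> 0" using ab by (simp add: sum_power2_eq_zero_iff)
  then show ?thesis
    unfolding of_nat_add a_def[symmetric] b_def[symmetric] ab(3,4)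
    using ab(1,2) by (simp add: divide_simps power2_eq_square) (simp add: algebra_simps)
qed

text \<open>Rewrites the rate in \<open>asymptotically_linear\<close> as multiplication by
  \<open>sqrt n\<close>. For \<open>n = 0\<close> both sides are 0.\<close>

lemma divide_powr_minus_half: "x / real n powr (- 1 / 2) = sqrt (real n) * x"
proof -
  have "real n powr (- 1 / 2) = inverse (sqrt (real n))"
    using powr_minus[of "real n" "1 / 2"] by (simp add: powr_half_sqrt)
  then have "x / real n powr (- 1 / 2) = x / inverse (sqrt (real n))"
    by (rule arg_cong)
  also have "\<dots> = sqrt (real n) * x"
    by (simp add: divide_inverse mult.commute)
  finally show ?thesis .
qed

section \<open>Asymptotic normality of the rectified estimator\<close>

text \<open>Kept general in the weight sequence, so that weight 0 also yields the limit law of the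
  unrectified estimator.\<close>

lemma rectified_estimator_conv_in_dist:
  fixes M :: "nat \<Rightarrow> 'w measure"
    and SX :: "'x measure" and SY :: "'y measure" and P :: "('x \<times> 'y) measure"
    and X :: "nat \<Rightarrow> nat \<Rightarrow> 'w \<Rightarrow> 'x" and Y :: "nat \<Rightarrow> nat \<Rightarrow> 'w \<Rightarrow> 'y"
  assumes P: "prob_space P" "sets P = sets (SX \<Otimes>\<^sub>M SY)"
    and sample: "\<And>k. semisupervised_sample (M k) SX SY P (X k) (Y k) (n k) (N k)"
    and sizes: "filterlim n at_top sequentially" "filterlim N at_top sequentially"
    and ratio: "(\<lambda>k. real (n k) / real (N k)) \<longlonglongrightarrow> lam"
    and infl: "influence_function P \<phi>" "influence_function (X_marginal SX P) \<psi>"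
    and \<theta>_meas: "\<And>k. \<theta>_hat k \<in> borel_measurable (Pi\<^sub>M {..<n k} (\<lambda>_. SX \<Otimes>\<^sub>M SY))"
    and \<theta>_linear:
      "asymptotically_linear M n n (\<lambda>k. labeled_data (X k) (Y k) {..<n k}) \<theta>_hat \<theta> \<phi>"
    and \<delta>_lab_meas: "\<And>k. \<delta>_lab k \<in> borel_measurable (Pi\<^sub>M {..<n k} (\<lambda>_. SX))"
    and \<delta>_lab_linear:
      "asymptotically_linear M n n (\<lambda>k. covariate_data (X k) {..<n k}) \<delta>_lab \<delta> \<psi>"
    and \<delta>_all_meas: "\<And>k. \<delta>_all k \<in> borel_measurable (Pi\<^sub>M {..<n k + N k} (\<lambda>_. SX))"
    and \<delta>_all_linear:
      "asymptotically_linear M n (\<lambda>k. n k + N k) (\<lambda>k. covariate_data (X k) {..<n k + N k})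
         \<delta>_all \<delta> \<psi>"
    and \<omega>_meas: "\<And>k. \<omega>_hat k \<in> borel_measurable (M k)"
    and \<omega>_lim: "conv_in_prob M \<omega>_hat \<omega>"
  shows "conv_in_dist M
       (\<lambda>k w. sqrt (real (n k)) *
         (rectified_estimator
            (\<theta>_hat k (labeled_data (X k) (Y k) {..<n k} w))
            (\<omega>_hat k w)
            (\<delta>_all k (covariate_data (X k) {..<n k + N k} w))
            (\<delta>_lab k (covariate_data (X k) {..<n k} w))
          - \<theta>))
       (normal_law 0 (asymp_var P \<phi> lam \<psi> \<omega>))"
proof -
  note lam = rectification_weights(1)[OF sizes(2) ratio]
  define c d where "c = 1 / (1 + lam)" and "d = sqrt lam / (1 + lam)"
  define ck where "ck k = real (N k) / real (n k + N k)" for k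
  define dk where "dk k = sqrt (real (n k)) * sqrt (real (N k)) / real (n k + N k)" for k
  define T where "T k w = \<theta>_hat k (labeled_data (X k) (Y k) {..<n k} w)" for k w
  define DA where "DA k w = \<delta>_all k (covariate_data (X k) {..<n k + N k} w)" for k w
  define DL where "DL k w = \<delta>_lab k (covariate_data (X k) {..<n k} w)" for k w
  define f where "f k w = (\<Sum>i<n k. \<phi> (X k i w, Y k i w))" for k w
  define u where "u k w = (\<Sum>i<n k. \<psi> (X k i w))" for k w
  define v where "v k w = (\<Sum>i\<in>{n k..<n k + N k}. \<psi> (X k i w))" for k w
  define U where "U k w = u k w / sqrt (real (n k))" for k w
  define V where "V k w = v k w / sqrt (real (N k))" for k w
  \<comment> \<open>\<open>A\<close>, \<open>B\<close> and \<open>C\<close> are the three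
    linearization remainders, all at scale \<open>sqrt (n k)\<close>; for the pooled estimator this
    is the scale at which its linearity is assumed.\<close>
  define A where "A k w = sqrt (real (n k)) * (T k w - \<theta> - f k w / real (n k))" for k w
  define B where "B k w = sqrt (real (n k)) * (DA k w - \<delta> - (u k w + v k w) / real (n k + N k))" for k w
  define C where "C k w = sqrt (real (n k)) * (DL k w - \<delta> - u k w / real (n k))" for k w
  define Z where "Z k w = sqrt (real (n k)) * (T k w + \<omega>_hat k w * (DA k w - DL k w) - \<theta>)" for k w
  \<comment> \<open>\<open>g\<close> and \<open>h\<close> carry the limits \<open>c\<close>,
    \<open>d\<close> and \<open>\<omega>\<close> in place of the stage-dependent weights, so that
    \<open>S\<close> consists of normalized sums of fixed functions.\<close>
  define g where "g z = \<phi> z - c * \<omega> * \<psi> (fst z)" for z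
  define h where "h x = \<omega> * d * \<psi> x" for x
  define S where "S k w = (\<Sum>i<n k. g (X k i w, Y k i w)) / sqrt (real (n k)) +
    (\<Sum>i\<in>{n k..<n k + N k}. h (X k i w)) / sqrt (real (N k))" for k w

  have fst: "fst \<in> measurable P SX"
    using measurable_fst[of SX SY] P(2) by (simp cong: measurable_cong_sets)
  have \<phi>: "\<phi> \<in> borel_measurable P" "integrable P (\<lambda>z. (\<phi> z)\<^sup>2)" "(\<integral>z. \<phi> z \<partial>P) = 0"
    using infl(1) by (auto simp: influence_function_def)
  have \<psi>: "\<psi> \<in> borel_measurable SX" "integrable P (\<lambda>z. (\<psi> (fst z))\<^sup>2)" "(\<integral>z. \<psi> (fst z) \<partial>P) = 0"
    using infl(2) by (auto simp: influence_function_X_marginal[OF fst])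
  have \<psi>P: "(\<lambda>z. \<psi> (fst z)) \<in> borel_measurable P"
    using fst \<psi>(1) by (rule measurable_compose)
  have infl\<psi>: "influence_function P (\<lambda>z. \<psi> (fst z))"
    using \<psi> \<psi>P by (simp add: influence_function_def)
  interpret P: prob_space P by fact
  note int1 = P.square_integrable_imp_integrable[OF \<phi>(1,2)] P.square_integrable_imp_integrable[OF \<psi>P \<psi>(2)]
  note int12 = integrable_mult_of_squares[OF \<phi>(1) \<psi>P \<phi>(2) \<psi>(2)]
  have g_sq: "(g z)\<^sup>2 = (\<phi> z)\<^sup>2 - 2 * c * \<omega> * (\<phi> z * \<psi> (fst z)) + (c * \<omega>)\<^sup>2 * (\<psi> (fst z))\<^sup>2" for z
    by (simp add: g_def power2_eq_square algebra_simps)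
  have inflg: "influence_function P g"
    unfolding influence_function_def g_sq
  proof (intro conjI)
    show "g \<in> borel_measurable P" "(\<integral>z. g z \<partial>P) = 0"
      unfolding g_def[abs_def] using \<phi> \<psi> \<psi>P int1 by simp_all
  qed (use \<phi> \<psi> int12 in simp)
  have inflh: "influence_function (X_marginal SX P) h"
    unfolding influence_function_X_marginal[OF fst] h_def[abs_def]
    using \<psi> by (simp add: power_mult_distrib)
  have d2: "c\<^sup>2 + d\<^sup>2 = c"
    using lam by (simp add: c_def d_def power_divide power2_eq_square divide_simps)
  have "(\<integral>x. (h x)\<^sup>2 \<partial>X_marginal SX P) = (\<integral>z. (h (fst z))\<^sup>2 \<partial>P)"
    using \<psi> by (intro integrable_X_marginal(2)[OF _ fst]) (simp add: h_def[abs_def])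
  also have "\<dots> = \<omega>\<^sup>2 * d\<^sup>2 * (\<integral>z. (\<psi> (fst z))\<^sup>2 \<partial>P)"
    by (simp add: h_def power_mult_distrib)
  finally have h_var: "(\<integral>x. (h x)\<^sup>2 \<partial>X_marginal SX P) = \<omega>\<^sup>2 * d\<^sup>2 * (\<integral>z. (\<psi> (fst z))\<^sup>2 \<partial>P)" .
  have "(\<integral>z. (g z)\<^sup>2 \<partial>P) = (\<integral>z. (\<phi> z)\<^sup>2 \<partial>P) - 2 * c * \<omega> * (\<integral>z. \<phi> z * \<psi> (fst z) \<partial>P)
      + (c * \<omega>)\<^sup>2 * (\<integral>z. (\<psi> (fst z))\<^sup>2 \<partial>P)"
    unfolding g_sq using \<phi> \<psi> int12 by simp
  then have "(\<integral>z. (g z)\<^sup>2 \<partial>P) + (\<integral>x. (h x)\<^sup>2 \<partial>X_marginal SX P) =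
      (\<integral>z. (\<phi> z)\<^sup>2 \<partial>P) - 2 * c * \<omega> * (\<integral>z. \<phi> z * \<psi> (fst z) \<partial>P)
      + \<omega>\<^sup>2 * (c\<^sup>2 + d\<^sup>2) * (\<integral>z. (\<psi> (fst z))\<^sup>2 \<partial>P)"
    unfolding h_var by (simp add: power_mult_distrib algebra_simps)
  also have "\<dots> = asymp_var P \<phi> lam \<psi> \<omega>"
    unfolding d2 by (simp add: asymp_var_def c_def)
  finally have var: "(\<integral>z. (g z)\<^sup>2 \<partial>P) + (\<integral>x. (h x)\<^sup>2 \<partial>X_marginal SX P) = asymp_var P \<phi> lam \<psi> \<omega>" .
  have var_nonneg: "asymp_var P \<phi> lam \<psi> \<omega> \<ge> 0"
    unfolding var[symmetric] by simp

  \<comment> \<open>The slot for the labeled function stays open: it is filled by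
    \<open>\<phi>\<close> or, for the second moment of \<open>U\<close>, by \<open>\<psi>\<close>
    composed with \<open>fst\<close>.\<close>
  note D = semisupervised_sampleD[OF sample P(2) _ \<psi>(1)]
  have prob: "prob_space (M k)" for k
    by (rule D(1)[OF \<phi>(1)])
  have XY: "(\<lambda>w. (X k i w, Y k i w)) \<in> measurable (M k) (SX \<Otimes>\<^sub>M SY)" if "i < n k" for k i
    by (rule D(2)[OF \<phi>(1) that])
  have Xm: "X k i \<in> measurable (M k) SX" if "i < n k + N k" for k i
    by (rule D(3)[OF \<phi>(1) that])
  have \<phi>': "\<phi> \<in> borel_measurable (SX \<Otimes>\<^sub>M SY)" and g': "g \<in> borel_measurable (SX \<Otimes>\<^sub>M SY)"
    using \<phi>(1) inflg P(2) by (simp_all add: influence_function_def cong: measurable_cong_sets)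
  have \<psi>X: "(\<lambda>w. \<psi> (X k i w)) \<in> borel_measurable (M k)" if "i < n k + N k" for k i
    using Xm[OF that] \<psi>(1) by (rule measurable_compose)
  have meas: "T k \<in> borel_measurable (M k)" "DA k \<in> borel_measurable (M k)" "DL k \<in> borel_measurable (M k)"
    "f k \<in> borel_measurable (M k)" "u k \<in> borel_measurable (M k)" "v k \<in> borel_measurable (M k)"
    "S k \<in> borel_measurable (M k)" for k
  proof -
    show "T k \<in> borel_measurable (M k)" unfolding T_def labeled_data_def
      by (rule measurable_compose[OF measurable_restrict \<theta>_meas]) (simp add: XY)
    show "DA k \<in> borel_measurable (M k)" unfolding DA_def covariate_data_def
      by (rule measurable_compose[OF measurable_restrict \<delta>_all_meas]) (simp add: Xm)
    show "DL k \<in> borel_measurable (M k)" unfolding DL_def covariate_data_def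
      by (rule measurable_compose[OF measurable_restrict \<delta>_lab_meas]) (simp add: Xm)
    show "f k \<in> borel_measurable (M k)" unfolding f_def
      by (rule borel_measurable_sum, rule measurable_compose[OF XY \<phi>']) simp
    show "u k \<in> borel_measurable (M k)" unfolding u_def
      by (rule borel_measurable_sum, rule \<psi>X) simp
    show "v k \<in> borel_measurable (M k)" unfolding v_def
      by (rule borel_measurable_sum, rule \<psi>X) simp
    have "(\<lambda>w. \<Sum>i<n k. g (X k i w, Y k i w)) \<in> borel_measurable (M k)"
      by (rule borel_measurable_sum, rule measurable_compose[OF XY g']) simp
    moreover have "(\<lambda>w. \<Sum>i\<in>{n k..<n k + N k}. h (X k i w)) \<in> borel_measurable (M k)"
      unfolding h_def by (rule borel_measurable_sum, rule borel_measurable_times[OF _ \<psi>X]) simp_all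
    ultimately show "S k \<in> borel_measurable (M k)"
      unfolding S_def by simp
  qed
  have meas2: "A k \<in> borel_measurable (M k)" "B k \<in> borel_measurable (M k)" "C k \<in> borel_measurable (M k)"
    "U k \<in> borel_measurable (M k)" "V k \<in> borel_measurable (M k)" "Z k \<in> borel_measurable (M k)" for k
    unfolding A_def B_def C_def U_def V_def Z_def using meas \<omega>_meas by simp_all

  have fsum: "(\<Sum>i<n k. \<phi> (labeled_data (X k) (Y k) {..<n k} w i)) = f k w" for k w
    unfolding f_def by (rule sum.cong) (simp_all add: labeled_data_def)
  have usum: "(\<Sum>i<n k. \<psi> (covariate_data (X k) {..<n k} w i)) = u k w" for k w
    unfolding u_def by (rule sum.cong) (simp_all add: covariate_data_def)
  have "(\<Sum>i<n k + N k. \<psi> (covariate_data (X k) {..<n k + N k} w i)) = (\<Sum>i<n k + N k. \<psi> (X k i w))" for k w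
    by (rule sum.cong) (simp_all add: covariate_data_def)
  also have "(\<Sum>i<n k + N k. \<psi> (X k i w)) = u k w + v k w" for k w
    unfolding u_def v_def lessThan_atLeast0 by (rule sum.atLeastLessThan_concat[symmetric]) simp_all
  finally have uvsum: "(\<Sum>i<n k + N k. \<psi> (covariate_data (X k) {..<n k + N k} w i)) = u k w + v k w" for k w .
  have A: "conv_in_prob M A 0"
    using \<theta>_linear unfolding asymptotically_linear_def small_op_def divide_powr_minus_half fsum
    by (simp add: A_def[abs_def] T_def)
  have B: "conv_in_prob M B 0"
    using \<delta>_all_linear unfolding asymptotically_linear_def small_op_def divide_powr_minus_half uvsum
    by (simp add: B_def[abs_def] DA_def)
  have C: "conv_in_prob M C 0"
    using \<delta>_lab_linear unfolding asymptotically_linear_def small_op_def divide_powr_minus_half usum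
    by (simp add: C_def[abs_def] DL_def)

  define K where "K = (\<integral>z. (\<psi> (fst z))\<^sup>2 \<partial>P)"
  have U2: "integrable (M k) (\<lambda>w. (U k w)\<^sup>2)" "(\<integral>w. (U k w)\<^sup>2 \<partial>M k) \<le> K" for k
    using prob_space.second_moment_normalized_iid_sum[OF prob _ D(4)[OF \<psi>P] D(5)[OF \<psi>P] infl\<psi>, of k]
    by (simp_all add: U_def u_def K_def)
  have V2: "integrable (M k) (\<lambda>w. (V k w)\<^sup>2)" "(\<integral>w. (V k w)\<^sup>2 \<partial>M k) \<le> K" for k
    using prob_space.second_moment_normalized_iid_sum[OF prob _ D(6)[OF \<phi>(1)] D(7)[OF \<phi>(1)] infl(2), of k]
      integrable_X_marginal(2)[OF _ fst, of "\<lambda>x. (\<psi> x)\<^sup>2"] \<psi>(1)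
    by (simp_all add: V_def v_def K_def)

  have ck: "conv_in_prob M (\<lambda>k _. ck k) c" and dk: "conv_in_prob M (\<lambda>k _. dk k) d"
    using rectification_weights(2,3)[OF sizes(2) ratio]
    by (auto intro!: conv_in_prob_const simp: ck_def dk_def c_def d_def)
  have constm: "(\<lambda>_. r) \<in> borel_measurable (M k)" for r :: real and k by simp
  \<comment> \<open>\<open>E1\<close> and \<open>E2\<close> are the coefficients of \<open>U\<close>
    and \<open>V\<close> left over in \<open>Z - S\<close> when the actual weights are replaced by
    their limits.\<close>
  define E1 where "E1 k w = - (\<omega>_hat k w * ck k) + c * \<omega>" for k w
  define E2 where "E2 k w = \<omega>_hat k w * dk k + - (\<omega> * d)" for k w
  have Em: "E1 k \<in> borel_measurable (M k)" "E2 k \<in> borel_measurable (M k)" for k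
    unfolding E1_def E2_def using \<omega>_meas by simp_all
  note mult = conv_in_prob_mult[OF prob] and add = conv_in_prob_add[OF prob]
  have neg: "conv_in_prob M (\<lambda>k w. - W k w) (- l)" if "conv_in_prob M W l" for W l
    using that unfolding conv_in_prob_def by (simp add: abs_minus_commute)
  have E1: "conv_in_prob M E1 0"
    using add[OF _ _ neg[OF mult[OF \<omega>_meas constm \<omega>_lim ck]] conv_in_prob_const[OF tendsto_const[of "c * \<omega>"]]] \<omega>_meas
    by (simp add: E1_def[abs_def] mult.commute)
  have E2: "conv_in_prob M E2 0"
    using add[OF _ _ mult[OF \<omega>_meas constm \<omega>_lim dk] conv_in_prob_const[OF tendsto_const[of "- (\<omega> * d)"]]] \<omega>_meas
    by (simp add: E2_def[abs_def])
  have E1U: "conv_in_prob M (\<lambda>k w. E1 k w * U k w) 0"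
    by (rule conv_in_prob_mult_bounded[OF prob Em(1) meas2(4) E1 U2])
  have E2V: "conv_in_prob M (\<lambda>k w. E2 k w * V k w) 0"
    by (rule conv_in_prob_mult_bounded[OF prob Em(2) meas2(5) E2 V2])
  have BC: "conv_in_prob M (\<lambda>k w. \<omega>_hat k w * (B k w + - C k w)) 0"
    using mult[OF \<omega>_meas _ \<omega>_lim add[OF meas2(2) _ B neg[OF C]]] meas2 by simp
  have R: "conv_in_prob M (\<lambda>k w. (A k w + \<omega>_hat k w * (B k w + - C k w)) + (E1 k w * U k w + E2 k w * V k w)) 0"
    using add[OF _ _ add[OF meas2(1) _ A BC] add[OF _ _ E1U E2V]] meas2 \<omega>_meas Em by simp
  \<comment> \<open>An exact identity, with no limit involved: linearization remainders first, then
    weight errors times normalized sums. All terms on the right are already known to vanish in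
    probability.\<close>
  have "Z k w - S k w = (A k w + \<omega>_hat k w * (B k w + - C k w)) + (E1 k w * U k w + E2 k w * V k w)" for k w
  proof -
    have "sqrt (real (n k)) * ((u k w + v k w) / real (n k + N k) - u k w / real (n k)) =
        - ck k * U k w + dk k * V k w"
      unfolding ck_def dk_def U_def V_def
      by (rule pooled_minus_labeled_mean) (simp_all add: u_def v_def)
    then have bc: "\<omega>_hat k w * (sqrt (real (n k)) * ((u k w + v k w) / real (n k + N k))
        - sqrt (real (n k)) * (u k w / real (n k))) = \<omega>_hat k w * (- ck k * U k w + dk k * V k w)"
      by (simp add: right_diff_distrib)
    have "S k w = f k w / sqrt (real (n k)) - c * \<omega> * U k w + \<omega> * d * V k w"
      by (simp add: S_def g_def h_def f_def U_def V_def u_def v_def sum_subtractf sum_distrib_left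
          diff_divide_distrib)
    moreover have "sqrt (real (n k)) * (f k w / real (n k)) = f k w / sqrt (real (n k))"
      by (cases "n k = 0") (simp_all add: divide_simps)
    ultimately show ?thesis
      using bc unfolding Z_def A_def B_def C_def E1_def E2_def
      by (simp only: right_diff_distrib) (simp add: algebra_simps)
  qed
  with R have rem: "conv_in_prob M (\<lambda>k w. Z k w - S k w) 0" by simp
  have "conv_in_dist M Z (normal_law 0 (asymp_var P \<phi> lam \<psi> \<omega>))"
  proof (rule conv_in_dist_slutsky[OF prob meas2(6) meas(7) rem _ real_distribution_normal_law[OF var_nonneg]])
    show "(\<lambda>k. char (distr (M k) borel (S k)) t) \<longlonglongrightarrow> char (normal_law 0 (asymp_var P \<phi> lam \<psi> \<omega>)) t" for t
      using semisupervised_char_limit[OF P sample sizes inflg inflh, of t]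
      by (simp add: S_def[abs_def] char_normal_law[OF var_nonneg] var)
  qed
  then show ?thesis
    by (simp add: Z_def[abs_def] T_def DA_def DL_def rectified_estimator_def)
qed

section \<open>Limit law, optimal weight and optimal influence function\<close>

theorem theorem2p1:
  fixes M :: "nat \<Rightarrow> 'w measure"
    and SX :: "'x measure" and SY :: "'y measure" and P :: "('x \<times> 'y) measure"
    and X :: "nat \<Rightarrow> nat \<Rightarrow> 'w \<Rightarrow> 'x" and Y :: "nat \<Rightarrow> nat \<Rightarrow> 'w \<Rightarrow> 'y"
    and n N :: "nat \<Rightarrow> nat" and lam \<omega> :: real
    and \<theta> :: "('x \<times> 'y) measure \<Rightarrow> real" and \<delta> :: "'x measure \<Rightarrow> real"
    and \<phi> :: "'x \<times> 'y \<Rightarrow> real" and \<psi> :: "'x \<Rightarrow> real"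
    and \<theta>_hat :: "nat \<Rightarrow> (nat \<Rightarrow> 'x \<times> 'y) \<Rightarrow> real"
    and \<delta>_lab \<delta>_all :: "nat \<Rightarrow> (nat \<Rightarrow> 'x) \<Rightarrow> real"
    and \<omega>_hat :: "nat \<Rightarrow> 'w \<Rightarrow> real"
    and submodels :: "(real \<Rightarrow> ('x \<times> 'y) measure) set"
  assumes P: "prob_space P" "sets P = sets (SX \<Otimes>\<^sub>M SY)"
    and sample: "\<And>k. semisupervised_sample (M k) SX SY P (X k) (Y k) (n k) (N k)"
    and sizes: "filterlim n at_top sequentially" "filterlim N at_top sequentially"
    and ratio: "(\<lambda>k. real (n k) / real (N k)) \<longlonglongrightarrow> lam"
    and submodels: "\<And>p. p \<in> submodels \<Longrightarrow> qmd_submodel P p"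
    and infl: "influence_function P \<phi>" "influence_function (X_marginal SX P) \<psi>"
    and \<theta>_meas: "\<And>k. \<theta>_hat k \<in> borel_measurable (Pi\<^sub>M {..<n k} (\<lambda>_. SX \<Otimes>\<^sub>M SY))"
    and \<theta>_regular: "regular_estimator submodels n \<theta>_hat \<theta>"
    and \<theta>_linear:
      "asymptotically_linear M n n (\<lambda>k. labeled_data (X k) (Y k) {..<n k}) \<theta>_hat (\<theta> P) \<phi>"
    and \<delta>_lab_meas: "\<And>k. \<delta>_lab k \<in> borel_measurable (Pi\<^sub>M {..<n k} (\<lambda>_. SX))"
    and \<delta>_lab_regular:
      "regular_estimator ((\<lambda>p t. X_marginal SX (p t)) ` submodels) n \<delta>_lab \<delta>"
    and \<delta>_lab_linear:
      "asymptotically_linear M n n (\<lambda>k. covariate_data (X k) {..<n k}) \<delta>_lab (\<delta> (X_marginal SX P)) \<psi>"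
    and \<delta>_all_meas: "\<And>k. \<delta>_all k \<in> borel_measurable (Pi\<^sub>M {..<n k + N k} (\<lambda>_. SX))"
    and \<delta>_all_regular:
      "regular_estimator ((\<lambda>p t. X_marginal SX (p t)) ` submodels) (\<lambda>k. n k + N k) \<delta>_all \<delta>"
    and \<delta>_all_linear:
      "asymptotically_linear M n (\<lambda>k. n k + N k) (\<lambda>k. covariate_data (X k) {..<n k + N k})
         \<delta>_all (\<delta> (X_marginal SX P)) \<psi>"
    and \<omega>_meas: "\<And>k. \<omega>_hat k \<in> borel_measurable (M k)"
    and \<omega>_lim: "conv_in_prob M \<omega>_hat \<omega>"
  shows
    "conv_in_dist M
       (\<lambda>k w. sqrt (real (n k)) *
         (rectified_estimator
            (\<theta>_hat k (labeled_data (X k) (Y k) {..<n k} w))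
            (\<omega>_hat k w)
            (\<delta>_all k (covariate_data (X k) {..<n k + N k} w))
            (\<delta>_lab k (covariate_data (X k) {..<n k} w))
          - \<theta> P))
       (normal_law 0 (asymp_var P \<phi> lam \<psi> \<omega>))
     \<and>
     ((\<forall>c. asymp_var P \<phi> lam \<psi> (omega_opt P \<phi> \<psi>) \<le> asymp_var P \<phi> lam \<psi> c) \<and>
     asymp_var P \<phi> lam \<psi> (omega_opt P \<phi> \<psi>) =
       (\<integral>z. (\<phi> z)\<^sup>2 \<partial>P)
       - (\<integral>z. \<phi> z * \<psi> (fst z) \<partial>P)\<^sup>2 / ((1 + lam) * (\<integral>z. (\<psi> (fst z))\<^sup>2 \<partial>P)) \<and>
     asymp_var P \<phi> lam \<psi> (omega_opt P \<phi> \<psi>) \<le> (\<integral>z. (\<phi> z)\<^sup>2 \<partial>P) \<and>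
     conv_in_dist M
       (\<lambda>k w. sqrt (real (n k)) * (\<theta>_hat k (labeled_data (X k) (Y k) {..<n k} w) - \<theta> P))
       (normal_law 0 (\<integral>z. (\<phi> z)\<^sup>2 \<partial>P)))
     \<and>
     (\<exists>h. regression_version SX P \<phi> h) \<and>
     (\<forall>h. regression_version SX P \<phi> h \<longrightarrow>
        influence_function (X_marginal SX P) h \<and>
        asymp_var P \<phi> lam h (omega_opt P \<phi> h) =
          (\<integral>z. (\<phi> z)\<^sup>2 \<partial>P)
          - 1 / (1 + lam) * prob_space.variance P (cond_exp_given_X SX P \<phi>) \<and>
        (\<forall>f. influence_function (X_marginal SX P) f \<longrightarrow>
           asymp_var P \<phi> lam h (omega_opt P \<phi> h) \<le> asymp_var P \<phi> lam f (omega_opt P \<phi> f)))"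
proof -
  have fst: "fst \<in> measurable P SX"
    using measurable_fst[of SX SY] P(2) by (simp cong: measurable_cong_sets)
  have \<phi>: "\<phi> \<in> borel_measurable P" "integrable P (\<lambda>z. (\<phi> z)\<^sup>2)"
    using infl(1) by (auto simp: influence_function_def)
  have lam: "lam \<ge> 0"
    by (rule rectification_weights(1)[OF sizes(2) ratio])
  have square: "(\<lambda>z. f (fst z)) \<in> borel_measurable P" "integrable P (\<lambda>z. (f (fst z))\<^sup>2)"
    if "influence_function (X_marginal SX P) f" for f
    using that measurable_compose[OF fst, of f borel] by (auto simp: influence_function_X_marginal[OF fst])
  note clt = rectified_estimator_conv_in_dist[OF P sample sizes ratio infl \<theta>_meas \<theta>_linear
    \<delta>_lab_meas \<delta>_lab_linear \<delta>_all_meas \<delta>_all_linear]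
  have i: "conv_in_dist M
       (\<lambda>k w. sqrt (real (n k)) *
         (rectified_estimator
            (\<theta>_hat k (labeled_data (X k) (Y k) {..<n k} w))
            (\<omega>_hat k w)
            (\<delta>_all k (covariate_data (X k) {..<n k + N k} w))
            (\<delta>_lab k (covariate_data (X k) {..<n k} w))
          - \<theta> P))
       (normal_law 0 (asymp_var P \<phi> lam \<psi> \<omega>))"
    by (rule clt[OF \<omega>_meas \<omega>_lim])
  \<comment> \<open>Weight 0 turns the rectified estimator into \<open>\<theta>_hat\<close> and the
    variance into the second moment of \<open>\<phi>\<close>.\<close>
  have \<theta>_clt: "conv_in_dist M
       (\<lambda>k w. sqrt (real (n k)) * (\<theta>_hat k (labeled_data (X k) (Y k) {..<n k} w) - \<theta> P))
       (normal_law 0 (\<integral>z. (\<phi> z)\<^sup>2 \<partial>P))"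
    using clt[of "\<lambda>_ _. 0" 0, OF _ conv_in_prob_const[OF tendsto_const]]
    by (simp add: rectified_estimator_def asymp_var_def)
  \<comment> \<open>Cauchy-Schwarz supplies the constant \<open>K\<close> as the second moment of
    \<open>\<phi>\<close>.\<close>
  have min: "asymp_var P \<phi> lam \<psi> (omega_opt P \<phi> \<psi>) \<le> asymp_var P \<phi> lam \<psi> c" for c
    by (rule asymp_var_omega_opt_le[OF lam integral_cauchy_schwarz[OF \<phi>(1) square(1) \<phi>(2) square(2)]])
       (rule infl(2))+
  \<comment> \<open>The minimum is compared with its competitor at weight 0.\<close>
  have ii: "asymp_var P \<phi> lam \<psi> (omega_opt P \<phi> \<psi>) \<le> (\<integral>z. (\<phi> z)\<^sup>2 \<partial>P)"
    using min[of 0] by (simp add: asymp_var_def)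
  have iii: "influence_function (X_marginal SX P) h \<and>
      asymp_var P \<phi> lam h (omega_opt P \<phi> h) =
        (\<integral>z. (\<phi> z)\<^sup>2 \<partial>P) - 1 / (1 + lam) * prob_space.variance P (cond_exp_given_X SX P \<phi>) \<and>
      (\<forall>f. influence_function (X_marginal SX P) f \<longrightarrow>
         asymp_var P \<phi> lam h (omega_opt P \<phi> h) \<le> asymp_var P \<phi> lam f (omega_opt P \<phi> f))"
    if h: "regression_version SX P \<phi> h" for h
  proof -
    note rv = regression_version_properties[OF P(1) fst infl(1) h]
    let ?H = "\<integral>z. (h (fst z))\<^sup>2 \<partial>P"
    \<comment> \<open>The mixed moment of \<open>\<phi>\<close> and \<open>h\<close> is
      \<open>?H\<close> itself, so the quotient \<open>?H\<^sup>2 / ?H\<close> collapses; for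
      \<open>?H = 0\<close> it is 0/0, which is again \<open>?H\<close>.\<close>
    have var_h: "asymp_var P \<phi> lam h (omega_opt P \<phi> h) = (\<integral>z. (\<phi> z)\<^sup>2 \<partial>P) - 1 / (1 + lam) * ?H"
      using rv(3)[OF rv(1)] lam
      by (cases "?H = 0") (simp_all add: asymp_var_omega_opt power2_eq_square)
    moreover have "asymp_var P \<phi> lam h (omega_opt P \<phi> h) \<le> asymp_var P \<phi> lam f (omega_opt P \<phi> f)"
      if f: "influence_function (X_marginal SX P) f" for f
    proof -
      let ?F = "\<integral>z. (f (fst z))\<^sup>2 \<partial>P" and ?b = "\<integral>z. h (fst z) * f (fst z) \<partial>P"
      have "?b\<^sup>2 \<le> ?H * ?F"
        by (rule integral_cauchy_schwarz[OF square(1)[OF rv(1)] square(1)[OF f] square(2)[OF rv(1)] square(2)[OF f]])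
      moreover have "?F \<ge> 0" by simp
      \<comment> \<open>For \<open>?F = 0\<close> the quotient below is 0 by the convention for
        division, and the bound reads \<open>0 \<le> ?H\<close>.\<close>
      then have "?F = 0 \<or> ?F > 0" by linarith
      ultimately have "?b\<^sup>2 / ?F \<le> ?H"
        by (elim disjE) (simp_all add: divide_le_eq)
      then have "?b\<^sup>2 / ?F / (1 + lam) \<le> ?H / (1 + lam)"
        using lam by (intro divide_right_mono) simp_all
      then show ?thesis
        unfolding var_h asymp_var_omega_opt[of P \<phi> lam f] rv(3)[OF f] by (simp add: mult.commute)
    qed
    ultimately show ?thesis
      using rv(1,2) by simp
  qed
  show ?thesis
    using i \<theta>_clt min ii asymp_var_omega_opt[of P \<phi> lam \<psi>] regression_version_exists[OF fst, of \<phi>] iii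
    by blast
qed

end
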